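(* Let $q$ be a prime power and let $n,k$ be integers with $k\geq 2$ and $n\geq 2k$. Then $$A^{*}_q(n,\{1,2,\ldots,k,n-k+1,\ldots,n-1\})\geq\frac{q^n-q^{k+r-1}}{q^{k-1}-1}+1,$$ where $r \equiv n \pmod{(k-1)}$ and $0\leq r<k-1$.
   Context: For integers $0<t_1<\cdots<t_s<n$, a flag of type $(t_1,\ldots,t_s)$ on $\mathbb F_q^n$ is a sequence $\mathcal F=(\mathcal F_1,\ldots,\mathcal F_s)$ of subspaces of $\mathbb F_q^n$ with $\dim\mathcal F_i=t_i$ and $\mathcal F_1\subsetneq\cdots\subsetneq\mathcal F_s$. The subspace distance is $d_S(\mathcal U,\mathcal V)=\dim\mathcal U+\dim\mathcal V-2\dim(\mathcal U\cap\mathcal V)$, and the flag distance is $d_f(\mathcal F,\mathcal F')=\sum_{i=1}^{s}d_S(\mathcal F_i,\mathcal F'_i)$. A flag code of type $(t_1,\ldots,t_s)$ is a nonempty set $\mathcal C$ of flags of this type; its minimum distance $d_f(\mathcal C)$ is the minimum of $d_f(\mathcal F,\mathcal F')$ over distinct $\mathcal F,\mathcal F'\in\mathcal C$. One always has $d_f(\mathcal C)\le d_{\max}$, where $$d_{\max}=2\Big(\sum_{t_i\leq \lfloor n/2\rfloor}t_i+\sum_{t_i> \lfloor n/2\rfloor}(n-t_i)\Big).$$ The code $\mathcal C$ is called an $(n,(t_1,\ldots,t_s))_q$ almost optimum distance flag code (AODFC) if $d_f(\mathcal C)=d_{\max}-2$. $A^{*}_q(n,\{t_1,\ldots,t_s\})$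 denotes the maximum number of flags in an $(n,(t_1,\ldots,t_s))_q$-AODFC. *)

theory Defs
  imports "HOL-Analysis.Cartesian_Space" "HOL-Number_Theory.Cong"
begin

text \<open>
  The space $F_q^n$ is the type \<^typ>\<open>'a ^ 'n\<close> with \<^typ>\<open>'a\<close> a finite field,
  so $q$ is the cardinality of \<^typ>\<open>'a\<close> (automatically a prime power) and $n$ that of
  the index type.  Flags are lists of subspaces; the list \<open>ts\<close> is the type vector.
  Distances are integers, so no subtraction below is truncated.
\<close>

definition is_flag :: "nat list \<Rightarrow> ('a::{field,finite} ^ 'n::finite) set list \<Rightarrow> bool" where
  "is_flag ts F \<longleftrightarrow>
     sorted_wrt (<) ts \<and> (\<forall>t \<in> set ts. 0 < t \<and> t < CARD('n)) \<and>
     length F = length ts \<and>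
     (\<forall>i < length ts. vec.subspace (F ! i) \<and> vec.dim (F ! i) = ts ! i) \<and>
     sorted_wrt (\<subset>) F"

definition subspace_dist ::
    "('a::{field,finite} ^ 'n::finite) set \<Rightarrow> ('a ^ 'n) set \<Rightarrow> int" where
  "subspace_dist U V = int (vec.dim U) + int (vec.dim V) - 2 * int (vec.dim (U \<inter> V))"

text \<open>Only meaningful for flags of the same type, i.e. lists of equal length.\<close>

definition flag_dist ::
    "('a::{field,finite} ^ 'n::finite) set list \<Rightarrow> ('a ^ 'n) set list \<Rightarrow> int" where
  "flag_dist F G = (\<Sum>i < length F. subspace_dist (F ! i) (G ! i))"

definition flag_code :: "nat list \<Rightarrow> ('a::{field,finite} ^ 'n::finite) set list set \<Rightarrow> bool" where
  "flag_code ts C \<longleftrightarrow> C \<noteq> {} \<and> (\<forall>F \<in> C. is_flag ts F)"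

text \<open>
  A code with a single flag has no pair of distinct flags; the usual convention
  that its minimum distance is \<open>0\<close> is adopted.
\<close>

definition min_flag_dist :: "('a::{field,finite} ^ 'n::finite) set list set \<Rightarrow> int" where
  "min_flag_dist C =
     (if card C \<le> 1 then 0
      else Min {flag_dist F G | F G. F \<in> C \<and> G \<in> C \<and> F \<noteq> G})"

definition max_flag_dist :: "nat \<Rightarrow> nat list \<Rightarrow> int" where
  "max_flag_dist n ts =
     2 * ((\<Sum>t | t \<in> set ts \<and> t \<le> n div 2. int t) +
          (\<Sum>t | t \<in> set ts \<and> t > n div 2. int n - int t))"

definition aodfc :: "nat list \<Rightarrow> ('a::{field,finite} ^ 'n::finite) set list set \<Rightarrow> bool" where
  "aodfc ts C \<longleftrightarrow> flag_code ts C \<and> min_flag_dist C = max_flag_dist CARD('n) ts - 2"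

text \<open>
  The maximum number of flags in an almost optimum distance flag code, the set \<open>T\<close>
  of dimensions being listed in increasing order to give the type vector.  The ambient
  space, hence $q$ and $n$, is passed as a type argument.  There are finitely many flags
  of a given type, so the maximum is over a finite set of numbers; it is meaningful
  whenever such a code exists.
\<close>

definition A_star :: "('a::{field,finite} ^ 'n::finite) itself \<Rightarrow> nat set \<Rightarrow> nat" where
  "A_star _ T = Max {card C | C :: ('a ^ 'n) set list set. aodfc (sorted_list_of_set T) C}"

end

theory Submission
  imports Defs "HOL-Algebra.Algebraic_Closure_Type"
begin

text \<open>
  Put \<open>t = k - 1\<close>. A flag of the required type is determined up to harmless choices by its members
  \<open>S \<subset> U \<subset> W\<close> of dimensions \<open>t\<close>, \<open>t + 1\<close>, \<open>n - t\<close>, and the distance of two flags is maximal up to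
  twice \<open>dim (U \<inter> U')\<close> as soon as \<open>S \<inter> S' = 0\<close> and \<open>W + W' = V\<close>. So one needs many triples
  with pairwise these two properties and \<open>dim (U \<inter> U') \<le> 1\<close>, with equality at least once.

  They are built by recursion on the dimension. Let \<open>V = T \<oplus> K\<close> with \<open>dim T = t\<close> and \<open>dim K = s\<close>, take
  a family of triples in \<open>K\<close>, one of its members \<open>(S\<^sub>1, U\<^sub>1, W\<^sub>1)\<close>, an embedding \<open>j\<close> of \<open>T\<close> onto a
  complement of \<open>W\<^sub>1\<close> in \<open>K\<close>, and \<open>z \<in> U\<^sub>1 \<inter> W\<^sub>1\<close> nonzero. The nonzero elements of the field with \<open>q^s\<close>
  elements act on \<open>K\<close>, and each of them turns \<open>(T, T + \<langle>z\<rangle>, T + W\<^sub>1)\<close> into a new triple by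
  \<open>x + y \<mapsto> x + A (j x + y)\<close>. Together with \<open>(T, T + \<langle>z\<rangle>, T + W\<^sub>1)\<close> itself, with \<open>(S\<^sub>1, U\<^sub>1, K)\<close> and
  with \<open>(S, U, T + W)\<close> for the other old triples, this adds \<open>q^s\<close> triples.
  Exchanging \<open>K\<close> and \<open>T + W\<^sub>1\<close> between the special triple and \<open>T\<close> is what makes \<open>S \<subseteq> W\<close> possible
  throughout although both the \<open>S\<close> and the \<open>W\<close> come from partial spreads.

  For \<open>r \<noteq> 0\<close> the recursion starts from a single triple in dimension \<open>t + r\<close>. For \<open>r = 0\<close> it starts
  in dimension \<open>3 t\<close>, where \<open>K\<close> carries a Desarguesian spread: every spread element \<open>S\<close> but one is
  enlarged by a common vector of \<open>T\<close>.
\<close>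

section \<open>Finite fields inside the algebraic closure\<close>

text \<open>Multiplication by a nonzero \<open>c\<close> permutes the nonzero elements, so their
  product is unchanged by the factor \<open>c ^ (CARD('a) - 1)\<close>, which must be 1.\<close>

lemma power_card_finite_field:
  fixes c :: "'a::{field,finite}"
  shows "c ^ CARD('a) = c"
proof (cases "c = 0")
  case True
  then show ?thesis by (simp add: power_0_left)
next
  case False
  let ?P = "\<Prod>x\<in>UNIV - {0::'a}. x"
  have "bij_betw ((*) c) (UNIV - {0}) (UNIV - {0})"
    by (rule bij_betwI[of _ _ _ "(*) (inverse c)"]) (use False in auto)
  then have "?P = (\<Prod>x\<in>UNIV - {0}. c * x)"
    using prod.reindex_bij_betw[of _ _ _ "\<lambda>x. x", symmetric] by blast
  also have "\<dots> = c ^ (CARD('a) - 1) * ?P"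
    by (simp add: prod.distrib card_Diff_subset)
  finally have "c ^ (CARD('a) - 1) = 1"
    by (simp add: prod_zero_iff)
  moreover have "CARD('a) = Suc (CARD('a) - 1)"
    by simp
  ultimately show ?thesis
    by (metis mult.right_neutral power_Suc)
qed

lemma card_field_ge_2: "2 \<le> CARD('a::{field,finite})"
proof -
  have "card {0, 1::'a} \<le> CARD('a)"
    by (rule card_mono) auto
  then show ?thesis by simp
qed

text \<open>Since \<open>x^q = x\<close>, the polynomial \<open>(X + 1)^q - X^q - 1\<close> vanishes on all \<open>q\<close> elements, but its
  degree is below \<open>q\<close>.\<close>
lemma of_nat_binomial_card_eq_0:
  assumes "0 < i" "i < CARD('a::{field,finite})"
  shows "of_nat (CARD('a) choose i) = (0::'a)"
proof -
  let ?q = "CARD('a)"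
  define p :: "'a poly" where "p = (\<Sum>i\<in>{0<..<?q}. monom (of_nat (?q choose i)) i)"
  have q: "?q \<ge> 2" by (rule card_field_ge_2)
  have root: "poly p x = 0" for x
  proof -
    have "{..?q} = insert 0 (insert ?q {0<..<?q})"
      using q by auto
    then have "(x + 1) ^ ?q = x ^ ?q + 1 + poly p x"
      using q by (subst binomial_ring) (simp add: p_def poly_sum poly_monom)
    then show ?thesis
      by (simp add: power_card_finite_field)
  qed
  have "degree p < ?q"
    unfolding p_def by (rule degree_sum_less)
      (use q in \<open>auto intro: le_less_trans[OF degree_monom_le]\<close>)
  moreover have "?q \<le> degree p" if "p \<noteq> 0"
  proof -
    have "{x. poly p x = 0} = UNIV" using root by auto
    then show ?thesis using card_poly_roots_bound[OF that] by simp
  qed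
  ultimately have "p = 0" by force
  then have "coeff p i = 0" by simp
  then show ?thesis
    using assms by (simp add: p_def coeff_sum sum.delta)
qed

lemma of_nat_card_eq_0: "of_nat CARD('a::{field,finite}) = (0::'a)"
  using of_nat_binomial_card_eq_0[of 1, where ?'a='a] card_field_ge_2[where ?'a='a] by simp

text \<open>The inner binomial coefficients vanish in the ground field, hence in its closure.
  Working with \<open>q\<close> itself avoids writing it as a power of the characteristic; the
  exponent \<open>q ^ s\<close> comes from iteration.\<close>

lemma frobenius_add:
  fixes x y :: "'a::{field,finite} alg_closure"
  shows "(x + y) ^ CARD('a) ^ s = x ^ CARD('a) ^ s + y ^ CARD('a) ^ s"
proof (induction s arbitrary: x y)
  case (Suc s)
  let ?q = "CARD('a)"
  have "(x + y) ^ ?q = x ^ ?q + y ^ ?q" for x y :: "'a alg_closure"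
  proof -
    have z: "of_nat (?q choose i) = (0::'a alg_closure)" if "i \<in> {0<..<?q}" for i
      using of_nat_binomial_card_eq_0[of i, where ?'a='a] that
      by (metis greaterThanLessThan_iff to_ac_0 to_ac_of_nat)
    have "{..?q} = insert 0 (insert ?q {0<..<?q})"
      by auto
    then show ?thesis
      by (simp add: binomial_ring z add.commute)
  qed
  then show ?case
    by (simp add: power_mult Suc)
qed simp

text \<open>For \<open>s \<noteq> 0\<close> this is the field with \<open>q ^ s\<close> elements, as
  the fixed points of an iterated Frobenius map. For \<open>s = 0\<close> the condition is void and
  gives the whole closure, whence the hypothesis \<open>s \<noteq> 0\<close> in the counting
  lemma.\<close>

definition fixed_field :: "nat \<Rightarrow> 'a::{field,finite} alg_closure set" where
  "fixed_field s = {x. x ^ CARD('a) ^ s = x}"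

lemma fixed_field_add: "x \<in> fixed_field s \<Longrightarrow> y \<in> fixed_field s \<Longrightarrow> x + y \<in> fixed_field s"
  by (simp add: fixed_field_def frobenius_add)

lemma fixed_field_mult: "x \<in> fixed_field s \<Longrightarrow> y \<in> fixed_field s \<Longrightarrow> x * y \<in> fixed_field s"
  by (simp add: fixed_field_def power_mult_distrib)

lemma fixed_field_inverse: "x \<in> fixed_field s \<Longrightarrow> inverse x \<in> fixed_field s"
  by (simp add: fixed_field_def power_inverse)

lemma fixed_field_0 [simp]: "0 \<in> fixed_field s"
  by (simp add: fixed_field_def)

lemma fixed_field_1 [simp]: "1 \<in> fixed_field s"
  by (simp add: fixed_field_def)

lemma fixed_field_to_ac: "to_ac c \<in> fixed_field s"
proof -
  have "c ^ CARD('a) ^ s = c" for c :: "'a::{field,finite}"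
    by (induction s) (simp_all add: power_mult power_card_finite_field)
  then show ?thesis
    by (simp add: fixed_field_def flip: to_ac_power)
qed

text \<open>Fixed points of a map are fixed by its iterates. This is the subfield inclusion behind
  the Desarguesian spread.\<close>

lemma fixed_field_mono: "fixed_field s \<subseteq> fixed_field (s * m)"
proof -
  have "x ^ (CARD('a) ^ s) ^ m = x" if "x ^ CARD('a) ^ s = x" for x :: "'a::{field,finite} alg_closure"
    using that by (induction m) (simp_all add: power_mult)
  then show ?thesis
    by (auto simp: fixed_field_def power_mult)
qed

text \<open>The elements are the roots of \<open>X ^ N - X\<close>, which splits over the closure
  and has derivative \<open>-1\<close>, hence has \<open>N\<close> distinct roots.\<close>

lemma card_fixed_field:
  assumes "s \<noteq> 0"
  shows "card (fixed_field s :: 'a::{field,finite} alg_closure set) = CARD('a) ^ s"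
proof -
  define N where "N = CARD('a) ^ s"
  have N: "N \<ge> 2"
    using card_field_ge_2[where ?'a='a] assms self_le_power[of "CARD('a)" s]
    by (simp add: N_def)
  have N0: "of_nat N = (0::'a alg_closure)"
  proof -
    have "of_nat N = (0::'a)"
      using assms by (simp add: N_def of_nat_card_eq_0)
    then show ?thesis by (metis to_ac_0 to_ac_of_nat)
  qed
  define p :: "'a alg_closure poly" where "p = monom 1 N - monom 1 1"
  have deg: "degree p = N"
    unfolding p_def diff_conv_add_uminus using N by (subst degree_add_eq_left) (auto simp: degree_monom_eq)
  have pd: "pderiv p = -1"
    using N0 by (simp add: p_def pderiv_diff pderiv_monom monom_0 one_pCons)
  have p0: "p \<noteq> 0" using pd by force
  \<comment> \<open>A multiple root would also be a root of the derivative.\<close>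
  have simple_root: "order a p \<le> 1" for a
  proof (rule ccontr)
    assume "\<not> order a p \<le> 1"
    then have "[:-a, 1:] ^ 2 dvd p"
      by (simp add: order_divides)
    then obtain r where r: "p = [:-a, 1:] ^ 2 * r" by (elim dvdE)
    define u where "u = [:-a, 1:]"
    have "p = u * (u * r)" "poly u a = 0"
      using r by (simp_all add: u_def power2_eq_square mult.assoc del: mult_pCons_left)
    then have "poly (pderiv p) a = 0"
      by (simp add: pderiv_mult)
    then show False using pd by simp
  qed
  obtain M c where M: "size M = degree p" "p = smult c (\<Prod>x\<in>#M. [:-x, 1:])"
    using alg_closed_imp_factorization[OF p0] by blast
  have ord: "order a p = count M a" for a
  proof -
    have "proots (\<Prod>x\<in>#M. [:-x, 1:]) = M"
    proof (induction M)
      case (add x M)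
      have "(\<Prod>x\<in>#M. [:-x, 1:]) \<noteq> 0"
        by (auto simp: prod_mset_zero_iff)
      then show ?case
        using add by (simp add: proots_mult del: mult_pCons_left)
    qed simp
    moreover have "c \<noteq> 0" using M(2) p0 by auto
    ultimately have "proots p = M"
      unfolding M(2) by (simp add: proots_smult)
    then show ?thesis
      using p0 by (simp flip: count_proots)
  qed
  have roots: "set_mset M = fixed_field s"
  proof -
    have "a \<in># M \<longleftrightarrow> poly p a = 0" for a
      using ord[of a] p0 by (simp add: order_root flip: count_greater_zero_iff)
    then show ?thesis
      by (auto simp: p_def poly_monom fixed_field_def N_def)
  qed
  have "count M a = 1" if "a \<in># M" for a
  proof -
    have "count M a > 0" using that by simp
    then show ?thesis using simple_root[of a] unfolding ord by linarith
  qed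
  then have "size M = card (set_mset M)"
    by (simp add: size_multiset_overloaded_eq)
  then show ?thesis
    using roots M(1) deg by (simp add: N_def)
qed

section \<open>Spread sets and Desarguesian spreads\<close>

text \<open>Each basis vector contributes a factor \<open>q\<close>. The scalar multiplication is a
  parameter because the count is applied both to \<open>'a ^ 'n\<close> and to the closure as a
  space over \<open>'a\<close>.\<close>

lemma card_span_independent:
  fixes scale :: "'a::{field,finite} \<Rightarrow> 'b::ab_group_add \<Rightarrow> 'b"
  assumes "vector_space scale" "finite B" "\<not> module.dependent scale B"
  shows "card (module.span scale B) = CARD('a) ^ card B"
proof -
  interpret vector_space scale by fact
  show ?thesis
    using assms(2,3)
  proof (induction B)
    case empty
    then show ?case by simp
  next
    case (insert b B)
    then have b: "b \<notin> span B" "independent B"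
      by (auto simp: independent_insert)
    let ?f = "\<lambda>(k, y). scale k b + y"
    have "inj_on ?f (UNIV \<times> span B)"
    proof (rule inj_onI, clarify)
      fix k y l z
      assume y: "y \<in> span B" "z \<in> span B" and eq: "scale k b + y = scale l b + z"
      then have e: "scale (k - l) b = z - y"
        by (simp add: algebra_simps)
      then have "scale (k - l) b \<in> span B"
        using y by (simp add: span_diff)
      then have "k = l"
        using b(1) span_scale[of "scale (k - l) b" B "inverse (k - l)"] by (cases "k = l") auto
      then show "k = l \<and> y = z" using eq by simp
    qed
    moreover have "?f ` (UNIV \<times> span B) = span (insert b B)"
    proof -
      have "x \<in> ?f ` (UNIV \<times> span B) \<longleftrightarrow> (\<exists>k. x - scale k b \<in> span B)" for x
      proof
        assume "x \<in> ?f ` (UNIV \<times> span B)"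
        then obtain k y where "y \<in> span B" "x = scale k b + y" by auto
        then have "x - scale k b \<in> span B" by simp
        then show "\<exists>k. x - scale k b \<in> span B" ..
      next
        assume "\<exists>k. x - scale k b \<in> span B"
        then obtain k where "x - scale k b \<in> span B" ..
        then show "x \<in> ?f ` (UNIV \<times> span B)"
          by (intro image_eqI[of _ _ "(k, x - scale k b)"]) auto
      qed
      then show ?thesis
        unfolding span_insert set_eq_iff mem_Collect_eq by (rule allI)
    qed
    ultimately have "card (span (insert b B)) = card ((UNIV :: 'a set) \<times> span B)"
      by (metis card_image)
    then show ?case
      using insert b by (simp add: card_cartesian_product)
  qed
qed

lemma card_subspace:
  fixes V :: "('a::{field,finite} ^ 'n::finite) set"
  assumes "vec.subspace V"
  shows "card V = CARD('a) ^ vec.dim V"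
proof -
  obtain B where B: "B \<subseteq> V" "vec.independent B" "V \<subseteq> vec.span B" "card B = vec.dim V"
    using vec.basis_exists by blast
  then have "vec.span B = V"
    using assms vec.span_minimal by blast
  then show ?thesis
    using card_span_independent[OF vec.vector_space_axioms _ B(2)] B by simp
qed

lemma dim_eqI_card:
  fixes V :: "('a::{field,finite} ^ 'n::finite) set"
  assumes "vec.subspace V" "card V = CARD('a) ^ d"
  shows "vec.dim V = d"
proof -
  have "CARD('a) ^ vec.dim V = CARD('a) ^ d"
    using card_subspace[OF assms(1)] assms(2) by simp
  then show ?thesis
    using card_field_ge_2[where ?'a='a] by (simp add: power_inject_exp)
qed

section \<open>The closure as a vector space over the ground field\<close>

definition scale_ac :: "'a::field \<Rightarrow> 'a alg_closure \<Rightarrow> 'a alg_closure" where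
  "scale_ac c x = to_ac c * x"

interpretation ac: vector_space scale_ac
  by unfold_locales (simp_all add: scale_ac_def algebra_simps)

interpretation ac_vec: vector_space_pair scale_ac "(*s) :: 'a::field \<Rightarrow> 'a ^ 'n::finite \<Rightarrow> _"
  by unfold_locales

interpretation vec_ac: vector_space_pair "(*s) :: 'a::field \<Rightarrow> 'a ^ 'n::finite \<Rightarrow> _" scale_ac
  by unfold_locales

lemma subspace_fixed_field: "ac.subspace (fixed_field s)"
  by (auto simp: ac.subspace_def scale_ac_def fixed_field_add fixed_field_mult fixed_field_to_ac)

text \<open>The dimension of the field over the ground field is read off its cardinality, and spaces
  of equal dimension are isomorphic. This puts a field structure on \<open>K\<close>.\<close>

lemma fixed_field_iso:
  fixes K :: "('a::{field,finite} ^ 'n::finite) set"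
  assumes K: "vec.subspace K" "vec.dim K = s" and "s \<noteq> 0"
  obtains \<phi> where "Vector_Spaces.linear scale_ac (*s) \<phi>"
    "bij_betw \<phi> (fixed_field s) K"
proof -
  have card: "card (fixed_field s :: 'a alg_closure set) = CARD('a) ^ s"
    by (rule card_fixed_field) fact
  have fin: "finite (fixed_field s :: 'a alg_closure set)"
    by (rule card_ge_0_finite) (simp add: card)
  obtain B :: "'a alg_closure set" where B: "B \<subseteq> fixed_field s" "ac.independent B"
    "fixed_field s \<subseteq> ac.span B" "card B = ac.dim (fixed_field s :: 'a alg_closure set)"
    using ac.basis_exists[of "fixed_field s"] by blast
  have fB: "finite B" using B(1) fin finite_subset by blast
  have "ac.span B = fixed_field s"
    using B subspace_fixed_field ac.span_minimal by blast
  then have "CARD('a) ^ card B = CARD('a) ^ s"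
    using card_span_independent[OF ac.vector_space_axioms fB B(2)] card by simp
  then have s: "card B = s"
    using card_field_ge_2[where ?'a='a] by (simp add: power_inject_exp)
  obtain C where C: "C \<subseteq> K" "vec.independent C" "K \<subseteq> vec.span C" "card C = vec.dim K"
    using vec.basis_exists by blast
  obtain \<phi> where "Vector_Spaces.linear scale_ac (*s) \<phi>" "\<phi> ` fixed_field s = K"
      "inj_on \<phi> (fixed_field s)"
    using ac_vec.finite_basis_to_basis_subspace_isomorphism[OF subspace_fixed_field K(1) _ fB B _ C]
      s K(2) B(4) by auto
  then show thesis
    by (intro that) (auto simp: bij_betw_def)
qed

text \<open>The maps live on the whole space, but the injectivity of members and of their
  differences concerns \<open>K\<close> only. This is a spread set in the sense of finite geometry,
  with the zero map left out.\<close>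

definition spread_set :: "('a::field ^ 'n::finite) set \<Rightarrow> ('a ^ 'n \<Rightarrow> 'a ^ 'n) set \<Rightarrow> bool" where
  "spread_set K \<A> \<longleftrightarrow>
     (\<forall>A\<in>\<A>. Vector_Spaces.linear (*s) (*s) A \<and> A ` K \<subseteq> K \<and> (\<forall>x\<in>K. A x = 0 \<longrightarrow> x = 0)) \<and>
     (\<forall>A\<in>\<A>. \<forall>B\<in>\<A>. A \<noteq> B \<longrightarrow> (\<forall>x\<in>K. A x = B x \<longrightarrow> x = 0))"

text \<open>The field multiplications on \<open>K\<close>, transported from \<open>F\<^sub>Q\<close> with \<open>Q = q^(tm)\<close>; the second family
  is the Desarguesian spread of the lines over the subfield with \<open>q^t\<close> elements.\<close>
lemma spread_set_and_spread:
  fixes K :: "('a::{field,finite} ^ 'n::finite) set"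
  assumes K: "vec.subspace K" "vec.dim K = t * m" and "t * m \<noteq> 0"
  obtains \<A> \<S> where "spread_set K \<A>" "card \<A> = CARD('a) ^ (t * m) - 1"
    "\<And>S. S \<in> \<S> \<Longrightarrow> vec.subspace S \<and> S \<subseteq> K \<and> vec.dim S = t"
    "\<And>S S'. S \<in> \<S> \<Longrightarrow> S' \<in> \<S> \<Longrightarrow> S \<noteq> S' \<Longrightarrow> S \<inter> S' = {0}"
    "\<Union>\<S> = K"
    "\<And>A S. A \<in> \<A> \<Longrightarrow> S \<in> \<S> \<Longrightarrow> A ` S \<in> \<S>"
proof -
  define F where "F = (fixed_field (t * m) :: 'a alg_closure set)"
  define L where "L = (fixed_field t :: 'a alg_closure set)"
  have LF: "L \<subseteq> F" unfolding L_def F_def by (rule fixed_field_mono)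
  obtain \<phi> where lin: "Vector_Spaces.linear scale_ac (*s) \<phi>" and bij: "bij_betw \<phi> F K"
    using fixed_field_iso[OF K] assms(3) unfolding F_def by blast
  have inj: "inj_on \<phi> F" and im: "\<phi> ` F = K"
    using bij by (auto simp: bij_betw_def)
  \<comment> \<open>\<open>g\<close> inverts \<open>\<phi>\<close> on \<open>K\<close> and is linear
    on the whole space with values in \<open>F\<close>, so the maps \<open>mul a\<close> below are
    linear everywhere.\<close>
  obtain g where g: "range g \<subseteq> F" "Vector_Spaces.linear (*s) scale_ac g" "\<And>v. v \<in> F \<Longrightarrow> g (\<phi> v) = v"
    using ac_vec.linear_exists_left_inverse_on[OF lin, of F] inj subspace_fixed_field
    unfolding F_def by blast
  have F: "0 \<in> F" "1 \<in> F" "\<And>x y. x \<in> F \<Longrightarrow> y \<in> F \<Longrightarrow> x * y \<in> F" "\<And>x. x \<in> F \<Longrightarrow> inverse x \<in> F"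
    by (auto simp: F_def fixed_field_mult fixed_field_inverse)
  have L: "0 \<in> L" "1 \<in> L" "\<And>x y. x \<in> L \<Longrightarrow> y \<in> L \<Longrightarrow> x * y \<in> L" "\<And>x. x \<in> L \<Longrightarrow> inverse x \<in> L"
    by (auto simp: L_def fixed_field_mult fixed_field_inverse)
  have gF: "g x \<in> F" for x using g(1) by auto
  have \<phi>g: "\<phi> (g x) = x" if "x \<in> K" for x using that im g(3) by auto
  have \<phi>_eq: "\<phi> x = \<phi> y \<longleftrightarrow> x = y" if "x \<in> F" "y \<in> F" for x y
    using that inj by (auto simp: inj_on_def)
  have \<phi>0: "\<phi> 0 = 0" by (rule ac_vec.linear_0[OF lin])
  define mul where "mul a = (\<lambda>x. \<phi> (a * g x))" for a
  define \<A> where "\<A> = mul ` (F - {0})"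
  have mulK: "mul a x \<in> K" if "a \<in> F" for a x
    using that F gF im by (auto simp: mul_def)
  have mul_inj: "a = b \<or> x = 0" if "a \<in> F" "b \<in> F" "x \<in> K" "mul a x = mul b x" for a b x
  proof -
    have "a * g x = b * g x"
      using that F gF \<phi>_eq unfolding mul_def by blast
    then show ?thesis
      using \<phi>g[OF that(3)] \<phi>0 by auto
  qed
  have mul0: "mul 0 x = 0" for x by (simp add: mul_def \<phi>0)
  have "spread_set K \<A>"
    unfolding spread_set_def
  proof (intro conjI ballI impI)
    fix A assume "A \<in> \<A>"
    then obtain a where a: "a \<in> F" "a \<noteq> 0" "A = mul a" by (auto simp: \<A>_def)
    show "Vector_Spaces.linear (*s) (*s) A"
      unfolding a(3) mul_def
    proof (rule Vector_Spaces.linear_compose[of _ _ "\<lambda>x. a * g x" _ \<phi>, unfolded o_def])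
      show "Vector_Spaces.linear (*s) scale_ac (\<lambda>x. a * g x)"
        using g(2) unfolding Vector_Spaces.linear_iff by (auto simp: algebra_simps scale_ac_def)
    qed (rule lin)
    show "A ` K \<subseteq> K" using mulK a by auto
    show "x = 0" if "x \<in> K" "A x = 0" for x
      using mul_inj[of a 0 x] that a F mul0 by auto
    show "x = 0" if "B \<in> \<A>" "A \<noteq> B" "x \<in> K" "A x = B x" for B x
      using mul_inj[of a] that a by (auto simp: \<A>_def)
  qed
  moreover have "card \<A> = CARD('a) ^ (t * m) - 1"
  proof -
    have "inj_on mul (F - {0})"
    proof (rule inj_onI)
      fix a b assume ab: "a \<in> F - {0}" "b \<in> F - {0}" "mul a = mul b"
      have "\<phi> 1 \<noteq> 0" using \<phi>_eq[of 1 0] F \<phi>0 by simp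
      moreover have "\<phi> 1 \<in> K" using im F by auto
      ultimately show "a = b" using mul_inj[of a b "\<phi> 1"] ab by auto
    qed
    then have "card \<A> = card (F - {0})"
      unfolding \<A>_def by (rule card_image)
    also have "\<dots> = CARD('a) ^ (t * m) - 1"
      using F card_fixed_field[OF assms(3), where ?'a='a] by (simp add: F_def card_Diff_subset)
    finally show ?thesis .
  qed
  moreover
  \<comment> \<open>For \<open>y \<noteq> 0\<close> this is the copy in \<open>K\<close> of a
    one-dimensional space over the subfield \<open>L\<close>, hence of dimension \<open>t\<close>
    over the ground field.\<close>
  define line where "line y = (\<lambda>a. \<phi> (y * a)) ` L" for y
  define \<S> where "\<S> = line ` (F - {0})"
  have line_eq: "line (z * c) = line z" if "c \<in> L" "c \<noteq> 0" for z c
  proof -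
    have "(*) c ` L = L"
    proof -
      have "x \<in> (*) c ` L" if "x \<in> L" for x
        using that \<open>c \<in> L\<close> \<open>c \<noteq> 0\<close> L by (intro image_eqI[of _ _ "inverse c * x"]) auto
      then show ?thesis using that L(3) by blast
    qed
    then have "(\<lambda>a. \<phi> (z * a)) ` (*) c ` L = line z"
      by (simp add: line_def)
    then show ?thesis
      by (simp add: line_def image_image mult.assoc)
  qed
  have "vec.subspace S \<and> S \<subseteq> K \<and> vec.dim S = t" if S: "S \<in> \<S>" for S
  proof -
    obtain y where y: "y \<in> F" "y \<noteq> 0" "S = line y" using S by (auto simp: \<S>_def)
    have "Vector_Spaces.linear scale_ac (*s) (\<lambda>a. \<phi> (y * a))"
    proof (rule Vector_Spaces.linear_compose[of _ _ "\<lambda>x. y * x" _ \<phi>, unfolded o_def])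
      show "Vector_Spaces.linear scale_ac scale_ac (\<lambda>x. y * x)"
        unfolding Vector_Spaces.linear_iff
        by (auto simp: algebra_simps scale_ac_def ac.vector_space_axioms)
    qed (rule lin)
    then have sub: "vec.subspace S"
      unfolding y(3) line_def L_def
      by (rule ac_vec.linear_subspace_image[OF _ subspace_fixed_field])
    have "inj_on (\<lambda>a. \<phi> (y * a)) L"
      using y LF F by (auto intro!: inj_onI simp: \<phi>_eq subset_iff)
    then have "card S = card L"
      unfolding y(3) line_def by (rule card_image)
    then have "vec.dim S = t"
      using card_fixed_field[of t, where ?'a='a] assms(3)
      by (intro dim_eqI_card sub) (auto simp: L_def)
    moreover have "S \<subseteq> K"
      using y LF F im by (auto simp: line_def subset_iff)
    ultimately show ?thesis using sub by blast
  qed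
  moreover have "S \<inter> S' = {0}" if S: "S \<in> \<S>" "S' \<in> \<S>" "S \<noteq> S'" for S S'
  proof -
    obtain y z where y: "y \<in> F" "y \<noteq> 0" "S = line y" and z: "z \<in> F" "z \<noteq> 0" "S' = line z"
      using S(1,2) by (auto simp: \<S>_def)
    have "v = 0" if v: "v \<in> S" "v \<in> S'" for v
    proof (rule ccontr)
      assume "v \<noteq> 0"
      obtain a b where a: "a \<in> L" "v = \<phi> (y * a)" and b: "b \<in> L" "v = \<phi> (z * b)"
        using v y(3) z(3) by (auto simp: line_def)
      \<comment> \<open>A shared nonzero vector makes \<open>y\<close> an \<open>L\<close>-multiple
        of \<open>z\<close>, so both give the same line.\<close>
      have eq: "y * a = z * b"
        using a b \<phi>_eq[of "y * a" "z * b"] y(1) z(1) F(3) LF by auto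
      have ab: "a \<noteq> 0" "b \<noteq> 0"
        using \<open>v \<noteq> 0\<close> a b \<phi>0 by auto
      then have "y = z * (b * inverse a)"
        using eq by (simp add: field_simps)
      moreover have "line (z * (b * inverse a)) = line z"
        by (rule line_eq) (use ab a b L in auto)
      ultimately show False
        using S(3) y(3) z(3) by simp
    qed
    moreover have "0 \<in> line y" for y
      using L(1) \<phi>0 by (force simp: line_def)
    ultimately show ?thesis using y(3) z(3) by blast
  qed
  moreover have "\<Union>\<S> = K"
  proof
    show "\<Union>\<S> \<subseteq> K"
      using LF F(3) im by (auto simp: \<S>_def line_def)
    show "K \<subseteq> \<Union>\<S>"
    proof
      fix v assume "v \<in> K"
      then obtain y where y: "y \<in> F" "v = \<phi> y" using im by auto
      \<comment> \<open>The zero vector lies on every line; the line through 1 is taken for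
        it.\<close>
      have "v \<in> line (if y = 0 then 1 else y)"
        using y(2) L(1,2) by (cases "y = 0") (force simp: line_def)+
      then show "v \<in> \<Union>\<S>"
        using y(1) F(2) by (auto simp: \<S>_def split: if_splits)
    qed
  qed
  \<comment> \<open>Multiplication by \<open>a\<close> carries the line through \<open>y\<close> to
    the line through \<open>a * y\<close>.\<close>
  moreover have "A ` S \<in> \<S>" if AS: "A \<in> \<A>" "S \<in> \<S>" for A S
  proof -
    obtain a y where a: "a \<in> F" "a \<noteq> 0" "A = mul a" and y: "y \<in> F" "y \<noteq> 0" "S = line y"
      using AS by (auto simp: \<S>_def \<A>_def)
    have "g (\<phi> (y * b)) = y * b" if "b \<in> L" for b
      using that y(1) LF F(3) by (intro g(3)) auto
    then have "A ` S = line (a * y)"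
      unfolding a(3) y(3) line_def mul_def image_image
      by (intro image_cong) (simp_all add: mult.assoc)
    then show ?thesis
      using a y F(3) by (auto simp: \<S>_def)
  qed
  ultimately show thesis using that by blast
qed

section \<open>Subspace sums, complements and families of triples\<close>

definition ssum :: "('a::field ^ 'n::finite) set \<Rightarrow> ('a ^ 'n) set \<Rightarrow> ('a ^ 'n) set" where
  "ssum A B = {x + y | x y. x \<in> A \<and> y \<in> B}"

lemma ssumI: "x \<in> A \<Longrightarrow> y \<in> B \<Longrightarrow> x + y \<in> ssum A B"
  by (auto simp: ssum_def)

lemma ssumE:
  assumes "v \<in> ssum A B"
  obtains x y where "x \<in> A" "y \<in> B" "v = x + y"
  using assms by (auto simp: ssum_def)

lemma subspace_ssum: "vec.subspace A \<Longrightarrow> vec.subspace B \<Longrightarrow> vec.subspace (ssum A B)"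
  unfolding ssum_def by (rule vec.subspace_sums)

lemma ssum_superset:
  assumes "vec.subspace A" "vec.subspace B"
  shows "A \<subseteq> ssum A B" "B \<subseteq> ssum A B"
proof
  show "v \<in> ssum A B" if "v \<in> A" for v
    using ssumI[OF that vec.subspace_0[OF assms(2)]] by simp
  show "B \<subseteq> ssum A B"
    using ssumI[OF vec.subspace_0[OF assms(1)], of _ B] by auto
qed

lemma ssum_least:
  assumes "A \<subseteq> V" "B \<subseteq> V" "vec.subspace V"
  shows "ssum A B \<subseteq> V"
  using assms by (auto simp: ssum_def vec.subspace_add subset_iff)

lemma ssum_mono: "A \<subseteq> A' \<Longrightarrow> B \<subseteq> B' \<Longrightarrow> ssum A B \<subseteq> ssum A' B'"
  by (auto simp: ssum_def)

lemma ssum_commute: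
  fixes A B :: "('a::field ^ 'n::finite) set"
  shows "ssum A B = ssum B A"
proof -
  have "ssum A B \<subseteq> ssum B A" for A B :: "('a ^ 'n) set"
  proof
    fix v assume "v \<in> ssum A B"
    then obtain x y where "x \<in> A" "y \<in> B" "v = x + y" by (rule ssumE)
    then show "v \<in> ssum B A"
      using ssumI[of y B x A] by (simp add: add.commute)
  qed
  then show ?thesis by blast
qed

lemma dim_ssum:
  assumes "vec.subspace A" "vec.subspace B" "A \<inter> B \<subseteq> {0}"
  shows "vec.dim (ssum A B) = vec.dim A + vec.dim B"
proof -
  have "vec.dim (A \<inter> B) = 0"
    using assms(3) by simp
  then show ?thesis
    using vec.dim_sums_Int[OF assms(1,2)] unfolding ssum_def by linarith
qed

lemma ssum_eqI:
  assumes "vec.subspace A" "vec.subspace B" "vec.subspace V" "A \<subseteq> V" "B \<subseteq> V" "A \<inter> B \<subseteq> {0}"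
    "vec.dim V \<le> vec.dim A + vec.dim B"
  shows "ssum A B = V"
  using assms dim_ssum[OF assms(1,2,6)]
  by (intro vec.subspace_dim_equal subspace_ssum ssum_least) auto

text \<open>A basis of \<open>K\<close> is extended to one of \<open>V\<close>; \<open>T\<close> is
  spanned by the new vectors, and \<open>p\<close> fixes these and kills the old ones.\<close>

lemma complement_projection:
  assumes K: "vec.subspace K" "K \<subseteq> V" and V: "vec.subspace V"
  obtains T p where "vec.subspace T" "T \<subseteq> V" "vec.dim V = vec.dim T + vec.dim K"
    "Vector_Spaces.linear (*s) (*s) p" "\<And>x. x \<in> T \<Longrightarrow> p x = x" "\<And>x. x \<in> K \<Longrightarrow> p x = 0"
    "T \<inter> K \<subseteq> {0}" "ssum T K = V"
proof -
  obtain C where C: "C \<subseteq> K" "vec.independent C" "K \<subseteq> vec.span C" "card C = vec.dim K"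
    using vec.basis_exists by blast
  have spC: "vec.span C = K" using C K vec.span_minimal by blast
  obtain D where D: "C \<subseteq> D" "D \<subseteq> V" "vec.independent D" "V \<subseteq> vec.span D"
    using vec.maximal_independent_subset_extend[of C V] C(1,2) K(2) by (metis subset_trans)
  have spD: "vec.span D = V" using D V vec.span_minimal by blast
  define T where "T = vec.span (D - C)"
  define p where "p = vec.construct D (\<lambda>b. if b \<in> C then 0 else b)"
  have p: "Vector_Spaces.linear (*s) (*s) p"
    unfolding p_def by (rule vec.linear_construct) (rule D)
  have pb: "p b = (if b \<in> C then 0 else b)" if "b \<in> D" for b
    unfolding p_def using D(3) that by (rule vec.construct_basis)
  have pT: "p x = x" if "x \<in> T" for x
    using vec.linear_eq_on[OF p vec.linear_id, of x "D - C"] pb that by (auto simp: T_def)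
  have pK: "p x = 0" if "x \<in> K" for x
  proof (rule vec.linear_eq_on[OF p vec.linear_zero, of x C])
    show "x \<in> vec.span C" using that spC by simp
    show "p b = 0" if "b \<in> C" for b using that pb D(1) by auto
  qed
  have T: "vec.subspace T" "T \<subseteq> V"
    using vec.span_mono[of "D - C" D] spD by (auto simp: T_def)
  have int: "T \<inter> K \<subseteq> {0}"
    using pT pK by fastforce
  have "vec.span D = vec.span ((D - C) \<union> C)"
    using D(1) by (simp add: Un_absorb2)
  also have "\<dots> = ssum T K"
    unfolding vec.span_Un T_def spC ssum_def ..
  finally have sum: "ssum T K = V" using spD by simp
  show thesis
    using that[OF T _ p pT pK int sum] dim_ssum[OF T(1) K(1) int] sum by simp
qed

section \<open>Criteria for small dimension\<close>

lemma dim_le_1I_span: "E \<subseteq> vec.span {u} \<Longrightarrow> vec.dim E \<le> 1"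
  using vec.dim_le_card[of E "{u}"] by simp

text \<open>Think of \<open>d\<close> as a coordinate of \<open>u\<close>: it respects linear
  combinations and only the zero vector has coordinate 0, so any two vectors of \<open>E\<close> are
  proportional. A relation is used because \<open>d\<close> comes from an existential description of
  \<open>u\<close>.\<close>

lemma dim_le_1I:
  fixes P :: "'a::field ^ 'n::finite \<Rightarrow> 'a \<Rightarrow> bool"
  assumes ex: "\<And>u. u \<in> E \<Longrightarrow> \<exists>d. P u d"
    and lin: "\<And>u v d e c. P u d \<Longrightarrow> P v e \<Longrightarrow> P (u - c *s v) (d - c * e)"
    and zero: "\<And>u. P u 0 \<Longrightarrow> u = 0"
  shows "vec.dim E \<le> 1"
proof (cases "E \<subseteq> {0}")
  case True
  then have "E \<subseteq> vec.span {0}" by simp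
  then show ?thesis by (rule dim_le_1I_span)
next
  case False
  then obtain v where v: "v \<in> E" "v \<noteq> 0" by auto
  then obtain e where e: "P v e" "e \<noteq> 0" using ex zero by metis
  have "u \<in> vec.span {v}" if u: "u \<in> E" for u
  proof -
    obtain d where "P u d" using ex u by blast
    from lin[OF this e(1), of "d / e"] e(2) have "P (u - (d / e) *s v) 0" by simp
    then have "u = (d / e) *s v" using zero by fastforce
    then show ?thesis by (auto simp: vec.span_singleton)
  qed
  then show ?thesis by (intro dim_le_1I_span[of _ v]) auto
qed

lemma dim_ge_1I:
  assumes "z \<in> E" "z \<noteq> 0"
  shows "1 \<le> vec.dim E"
proof -
  have "vec.dim E \<noteq> 0"
    using assms vec.dim_eq_0[of E] by blast
  then show ?thesis by linarith
qed

text \<open>Injectivity gives surjectivity because \<open>K\<close> is finite. This will make the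
  large members of two graph triples span \<open>V\<close>.\<close>

lemma spread_set_diff_surj:
  fixes K :: "('a::{field,finite} ^ 'n::finite) set"
  assumes "spread_set K \<A>" "A \<in> \<A>" "B \<in> \<A>" "A \<noteq> B" "vec.subspace K"
  shows "(\<lambda>x. A x - B x) ` K = K"
proof -
  have lin: "Vector_Spaces.linear (*s) (*s) (\<lambda>x. A x - B x)"
    using assms by (intro vec.linear_compose_sub) (auto simp: spread_set_def)
  have "inj_on (\<lambda>x. A x - B x) K"
    using assms(1-4) by (subst vec.linear_inj_on_iff_eq_0[OF lin assms(5)]) (auto simp: spread_set_def)
  moreover have "(\<lambda>x. A x - B x) ` K \<subseteq> K"
    using assms by (auto simp: spread_set_def intro!: vec.subspace_diff)
  ultimately show ?thesis
    by (intro endo_inj_surj) auto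
qed

lemma spread_set_surj:
  fixes K :: "('a::{field,finite} ^ 'n::finite) set"
  assumes "spread_set K \<A>" "A \<in> \<A>" "vec.subspace K"
  shows "A ` K = K"
proof -
  have lin: "Vector_Spaces.linear (*s) (*s) A"
    using assms by (auto simp: spread_set_def)
  have "inj_on A K"
    using assms by (subst vec.linear_inj_on_iff_eq_0[OF lin assms(3)]) (auto simp: spread_set_def)
  then show ?thesis
    using assms by (intro endo_inj_surj) (auto simp: spread_set_def)
qed

text \<open>A triple \<open>(S, U, W)\<close> stands for the members of dimensions \<open>k - 1\<close>, \<open>k\<close> and \<open>n - k + 1\<close> of
  a flag, with \<open>t = k - 1\<close>. The inclusion \<open>U \<subseteq> W\<close> is not part of the definition, since one
  triple of the induction basis lacks it.\<close>
definition is_triple ::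
    "nat \<Rightarrow> ('a::field ^ 'n::finite) set \<Rightarrow> ('a ^ 'n) set \<times> ('a ^ 'n) set \<times> ('a ^ 'n) set \<Rightarrow> bool" where
  "is_triple t V = (\<lambda>(S, U, W).
     vec.subspace S \<and> vec.subspace U \<and> vec.subspace W \<and> S \<subseteq> U \<and> U \<subseteq> V \<and> W \<subseteq> V \<and>
     vec.dim S = t \<and> vec.dim U = t + 1 \<and> vec.dim W + t = vec.dim V)"

text \<open>The first and last conditions put the members of dimension at most \<open>t\<close> and
  at least \<open>dim V - t\<close> as far apart as possible; the middle one allows a loss of 2 at
  dimension \<open>t + 1\<close>.\<close>

definition triple_compat ::
    "('a::field ^ 'n::finite) set \<Rightarrow> ('a ^ 'n) set \<times> ('a ^ 'n) set \<times> ('a ^ 'n) set \<Rightarrow>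
     ('a ^ 'n) set \<times> ('a ^ 'n) set \<times> ('a ^ 'n) set \<Rightarrow> bool" where
  "triple_compat V = (\<lambda>(S, U, W) (S', U', W').
     S \<inter> S' \<subseteq> {0} \<and> vec.dim (U \<inter> U') \<le> 1 \<and> V \<subseteq> ssum W W')"

definition triple_family ::
    "nat \<Rightarrow> ('a::field ^ 'n::finite) set \<Rightarrow> (('a ^ 'n) set \<times> ('a ^ 'n) set \<times> ('a ^ 'n) set) set \<Rightarrow> bool" where
  "triple_family t V \<G> \<longleftrightarrow> Ball \<G> (is_triple t V) \<and> pairwise (triple_compat V) \<G>"

lemma compat_sym: "triple_compat V p p' \<Longrightarrow> triple_compat V p' p"
  by (auto simp: triple_compat_def Int_commute ssum_commute split: prod.splits)

text \<open>Compatible triples are therefore distinct, so cardinalities of families follow from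
  compatibility.\<close>

lemma not_compat_self:
  assumes "is_triple t V p" "t \<noteq> 0"
  shows "\<not> triple_compat V p p"
proof
  obtain S U W where p: "p = (S, U, W)" by (cases p)
  assume "triple_compat V p p"
  then have "S \<subseteq> {0}" by (auto simp: p triple_compat_def)
  then have "vec.dim S = 0" by simp
  then show False using assms by (simp add: p is_triple_def del: vec.dim_eq_0)
qed

section \<open>Lifting triples along a spread set\<close>

text \<open>For \<open>V = T \<oplus> K\<close>, a map \<open>A\<close> of the spread set gives the automorphism
  \<open>x + k \<mapsto> x + A (j x + k)\<close> of \<open>V\<close>; the images of \<open>T\<close> are the graphs
  of the maps \<open>A \<circ> j\<close>, the lifted MRD code part of the classical partial spread.\<close>
locale twisted_sum =
  fixes T K R :: "('a::{field,finite} ^ 'n::finite) set" and p j :: "'a ^ 'n \<Rightarrow> 'a ^ 'n"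
    and z :: "'a ^ 'n" and \<A> :: "('a ^ 'n \<Rightarrow> 'a ^ 'n) set"
  assumes subT: "vec.subspace T" and subK: "vec.subspace K" and subR: "vec.subspace R" "R \<subseteq> K"
    and p: "Vector_Spaces.linear (*s) (*s) p" "\<And>x. x \<in> T \<Longrightarrow> p x = x" "\<And>x. x \<in> K \<Longrightarrow> p x = 0"
    and j: "Vector_Spaces.linear (*s) (*s) j" "\<And>x. x \<in> T \<Longrightarrow> j x \<in> K"
      "\<And>x. x \<in> T \<Longrightarrow> j x \<in> R \<Longrightarrow> x = 0"
    and dimK: "vec.dim K = vec.dim T + vec.dim R" and dimT: "vec.dim T \<noteq> 0"
    and z: "z \<in> R" "z \<noteq> 0"
    and spread: "spread_set K \<A>"
begin

definition "V = ssum T K"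
definition "U\<^sub>0 = vec.span (insert z T)"
text \<open>\<open>R\<close> has codimension \<open>dim T\<close> in \<open>K\<close>, so
  \<open>W\<^sub>0\<close> has codimension \<open>dim T\<close> in \<open>V\<close>. In the
  extension step \<open>R\<close> is the large member of the special old triple; in dimension
  \<open>3 t\<close> it is a spread element.\<close>

definition "W\<^sub>0 = ssum T R"
definition "\<theta> A v = p v + A (j (p v) + (v - p v))"
definition "origin_triple = (T, U\<^sub>0, W\<^sub>0)"
definition "graph_triple A = (\<theta> A ` T, \<theta> A ` U\<^sub>0, \<theta> A ` W\<^sub>0)"

section \<open>Components with respect to \<open>T\<close> and \<open>K\<close>\<close>

lemma A_lin: "A \<in> \<A> \<Longrightarrow> Vector_Spaces.linear (*s) (*s) A"
  and A_K: "A \<in> \<A> \<Longrightarrow> x \<in> K \<Longrightarrow> A x \<in> K"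
  and A_zero: "A \<in> \<A> \<Longrightarrow> x \<in> K \<Longrightarrow> A x = 0 \<Longrightarrow> x = 0"
  and A_diff: "A \<in> \<A> \<Longrightarrow> B \<in> \<A> \<Longrightarrow> A \<noteq> B \<Longrightarrow> x \<in> K \<Longrightarrow> A x = B x \<Longrightarrow> x = 0"
  using spread by (auto simp: spread_set_def)

lemma TK: "x \<in> T \<Longrightarrow> x \<in> K \<Longrightarrow> x = 0"
  using p by metis

text \<open>Applying \<open>p\<close> isolates the \<open>T\<close> components. Most intersections
  below are handled by comparing components in this way.\<close>

lemma split_eq:
  assumes "x \<in> T" "x' \<in> T" "k \<in> K" "k' \<in> K" "x + k = x' + k'"
  shows "x = x'" "k = k'"
proof -
  have "p (x + k) = p (x' + k')" using assms by simp
  then show "x = x'"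
    unfolding vec.linear_add[OF p(1)] using assms(1-4) p(2,3) by simp
  then show "k = k'" using assms by simp
qed

lemma zK: "z \<in> K" using z subR by auto

lemma zT: "z \<notin> T" using TK zK z by auto

lemma subU: "vec.subspace U\<^sub>0" by (simp add: U\<^sub>0_def)

lemma subW: "vec.subspace W\<^sub>0" by (simp add: W\<^sub>0_def subspace_ssum subT subR)

lemma subV: "vec.subspace V" by (simp add: V_def subspace_ssum subT subK)

lemma dimV: "vec.dim V = vec.dim T + vec.dim K"
  unfolding V_def using TK by (intro dim_ssum subT subK) auto

lemma span_T: "vec.span T = T"
  using subT by (simp add: vec.span_eq_iff)

lemma U_iff: "u \<in> U\<^sub>0 \<longleftrightarrow> (\<exists>x\<in>T. \<exists>c. u = x + c *s z)"
proof -
  have "(\<exists>c. u - c *s z \<in> T) \<longleftrightarrow> (\<exists>x\<in>T. \<exists>c. u = x + c *s z)"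
  proof
    assume "\<exists>c. u - c *s z \<in> T"
    then obtain c where "u - c *s z \<in> T" ..
    then show "\<exists>x\<in>T. \<exists>c. u = x + c *s z"
      by (intro bexI[of _ "u - c *s z"] exI[of _ c]) auto
  next
    assume "\<exists>x\<in>T. \<exists>c. u = x + c *s z"
    then obtain x c where "x \<in> T" "u = x + c *s z" by blast
    then have "u - c *s z \<in> T" by simp
    then show "\<exists>c. u - c *s z \<in> T" ..
  qed
  then show ?thesis
    by (simp add: U\<^sub>0_def vec.span_insert span_T)
qed

lemma T_sub_U: "T \<subseteq> U\<^sub>0"
  unfolding U\<^sub>0_def by (meson subset_insertI subset_trans vec.span_superset)

lemma z_in_U: "z \<in> U\<^sub>0"
  by (simp add: U\<^sub>0_def vec.span_base)

lemma T_sub_W: "T \<subseteq> W\<^sub>0" and R_sub_W: "R \<subseteq> W\<^sub>0"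
  unfolding W\<^sub>0_def by (rule ssum_superset[OF subT subR(1)])+

lemma U_sub_W: "U\<^sub>0 \<subseteq> W\<^sub>0"
  unfolding U\<^sub>0_def by (rule vec.span_minimal) (use T_sub_W R_sub_W z subW in auto)

lemma W_sub_V: "W\<^sub>0 \<subseteq> V"
  unfolding W\<^sub>0_def V_def using subR by (intro ssum_mono) auto

lemma origin_is_triple: "is_triple (vec.dim T) V origin_triple"
proof -
  have "vec.dim U\<^sub>0 = vec.dim T + 1"
    using zT by (simp add: U\<^sub>0_def vec.dim_insert span_T)
  moreover have "vec.dim W\<^sub>0 = vec.dim T + vec.dim R"
    unfolding W\<^sub>0_def using TK subR by (intro dim_ssum subT) auto
  ultimately show ?thesis
    using subT subU subW T_sub_U U_sub_W W_sub_V dimV dimK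
    by (auto simp: origin_triple_def is_triple_def)
qed

section \<open>The automorphisms attached to the spread set\<close>

lemma theta_apply: "x \<in> T \<Longrightarrow> k \<in> K \<Longrightarrow> \<theta> A (x + k) = x + A (j x + k)"
  using p(2,3) by (simp add: \<theta>_def vec.linear_add[OF p(1)])

lemma theta_lin:
  assumes "A \<in> \<A>"
  shows "Vector_Spaces.linear (*s) (*s) (\<theta> A)"
proof -
  note l = A_lin[OF assms] p(1) j(1)
  show ?thesis
    unfolding Vector_Spaces.linear_iff \<theta>_def
    by (auto simp: vec.linear_add[OF l(1)] vec.linear_add[OF l(2)] vec.linear_add[OF l(3)]
        vec.linear_scale[OF l(1)] vec.linear_scale[OF l(2)] vec.linear_scale[OF l(3)]
        vec.linear_diff[OF l(1)] vec.vector_space_axioms algebra_simps vec.scale_right_diff_distrib)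
qed

lemma theta_V:
  assumes "A \<in> \<A>" "v \<in> V"
  shows "\<theta> A v \<in> V"
proof -
  obtain x k where v: "x \<in> T" "k \<in> K" "v = x + k"
    using assms(2) unfolding V_def by (rule ssumE)
  have "A (j x + k) \<in> K"
    by (intro A_K[OF assms(1)] vec.subspace_add[OF subK] j(2) v(1,2))
  then show ?thesis
    using v by (auto simp: theta_apply V_def intro: ssumI)
qed

lemma theta_inj:
  assumes "A \<in> \<A>"
  shows "inj_on (\<theta> A) V"
proof (subst vec.linear_inj_on_iff_eq_0[OF theta_lin[OF assms] subV], intro ballI impI)
  fix v assume "v \<in> V" and 0: "\<theta> A v = 0"
  then obtain x k where v: "x \<in> T" "k \<in> K" "v = x + k"
    unfolding V_def by (elim ssumE)
  have K: "j x + k \<in> K" by (intro vec.subspace_add[OF subK] j(2) v(1,2))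
  have e: "x + A (j x + k) = 0 + 0" using 0 v by (simp add: theta_apply)
  have "x = 0" "A (j x + k) = 0"
    using split_eq[OF v(1) vec.subspace_0[OF subT] A_K[OF assms K] vec.subspace_0[OF subK] e] .
  then have "j x + k = 0" using A_zero assms K by blast
  then show "v = 0" using v(3) \<open>x = 0\<close> vec.linear_0[OF j(1)] by simp
qed

text \<open>\<open>\<theta> A\<close> is linear, injective on \<open>V\<close> and maps
  \<open>V\<close> into itself, so dimensions and inclusions are inherited from
  \<open>origin_triple\<close>.\<close>

lemma graph_is_triple:
  assumes A: "A \<in> \<A>"
  shows "is_triple (vec.dim T) V (graph_triple A)"
proof -
  note lin = theta_lin[OF A]
  have dim: "vec.dim (\<theta> A ` D) = vec.dim D" if "vec.subspace D" "D \<subseteq> V" for D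
    using that inj_on_subset[OF theta_inj[OF A], of D] by (intro vec.dim_image_eq[OF lin]) (simp add: vec.span_eq_iff[THEN iffD2])
  have sub: "vec.subspace (\<theta> A ` D)" if "vec.subspace D" for D
    by (rule vec.linear_subspace_image[OF lin that])
  show ?thesis
    using origin_is_triple sub dim theta_V[OF A] U_sub_W W_sub_V
    by (auto simp: graph_triple_def is_triple_def origin_triple_def dest: subsetD)
qed

lemma jzK: "x \<in> T \<Longrightarrow> j x + c *s z \<in> K"
  by (intro vec.subspace_add[OF subK] vec.subspace_scale[OF subK] j(2) zK)

lemma j_eq: "x \<in> T \<Longrightarrow> j x + c *s z = 0 \<Longrightarrow> x = 0 \<and> c = 0"
proof -
  assume x: "x \<in> T" "j x + c *s z = 0"
  then have "j x = (- c) *s z" by (simp add: eq_neg_iff_add_eq_0)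
  then have "j x \<in> R" using z subR vec.subspace_scale by metis
  then have "x = 0" using j x by blast
  then show ?thesis using x z vec.linear_0[OF j(1)] by simp
qed

lemma theta_U:
  assumes "u \<in> \<theta> A ` U\<^sub>0"
  obtains x c where "x \<in> T" "u = x + A (j x + c *s z)"
  using assms zK subK by (auto simp: U_iff theta_apply vec.subspace_scale)

lemma theta_T:
  assumes "u \<in> \<theta> A ` T"
  obtains x where "x \<in> T" "u = x + A (j x)"
proof -
  obtain x where "x \<in> T" "u = \<theta> A (x + 0)" using assms by auto
  then show thesis
    using that theta_apply[of x 0 A] subK vec.subspace_0 by force
qed

text \<open>By a dimension count \<open>K\<close> is the direct sum of \<open>R\<close> and the
  image of \<open>T\<close> under \<open>j\<close>. Hence the \<open>K\<close> components
  \<open>A (j x + r)\<close> of the transformed \<open>W\<^sub>0\<close> fill the image of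
  \<open>K\<close> under \<open>A\<close>.\<close>

lemma K_sub_jR:
  assumes "k \<in> K"
  obtains x r where "x \<in> T" "r \<in> R" "k = j x + r"
proof -
  have "inj_on j T"
    using j(3) vec.subspace_0[OF subR(1)]
    by (subst vec.linear_inj_on_iff_eq_0[OF j(1) subT]) auto
  then have "vec.dim (j ` T) = vec.dim T"
    by (intro vec.dim_image_eq[OF j(1)]) (simp add: span_T)
  moreover have "j ` T \<inter> R \<subseteq> {0}"
    using j vec.linear_0[OF j(1)] by auto
  moreover have "vec.subspace (j ` T)"
    by (rule vec.linear_subspace_image[OF j(1) subT])
  ultimately have "ssum (j ` T) R = K"
    using subR subK j dimK by (intro ssum_eqI) auto
  then show thesis using assms that by (auto elim!: ssumE)
qed

lemma theta_W:
  assumes "x \<in> T" "r \<in> R"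
  shows "x + A (j x + r) \<in> \<theta> A ` W\<^sub>0"
  using assms subR theta_apply[of x r A] by (auto simp: W\<^sub>0_def intro!: image_eqI[of _ _ "x + r"] ssumI)

section \<open>Compatibility of the new triples\<close>

lemma V_sub_ssum:
  assumes "vec.subspace D" "T \<subseteq> D" "K \<subseteq> D"
  shows "V \<subseteq> D"
  unfolding V_def using assms by (intro ssum_least) auto

text \<open>Common vectors have equal \<open>T\<close> components, so everything reduces to
  \<open>A\<close> and \<open>B\<close> on \<open>K\<close>, where they agree only at 0 and their
  difference is onto.\<close>

lemma compat_graphs:
  assumes A: "A \<in> \<A>" and B: "B \<in> \<A>" and AB: "A \<noteq> B"
  shows "triple_compat V (graph_triple A) (graph_triple B)"
proof -
  have "v = 0" if v: "v \<in> \<theta> A ` T" "v \<in> \<theta> B ` T" for v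
  proof -
    obtain x y where x: "x \<in> T" "v = x + A (j x)" and y: "y \<in> T" "v = y + B (j y)"
      using v by (auto elim!: theta_T)
    have "x = y" "A (j x) = B (j y)"
      using split_eq[of x y "A (j x)" "B (j y)"] x y A B A_K j by auto
    then have "j x = 0" using A_diff[OF A B AB, of "j x"] j x by auto
    then have "x = 0" using j_eq[of x 0] x by simp
    then show ?thesis using x \<open>j x = 0\<close> vec.linear_0[OF A_lin[OF A]] by simp
  qed
  then have "\<theta> A ` T \<inter> \<theta> B ` T \<subseteq> {0}" by auto
  moreover have "vec.dim (\<theta> A ` U\<^sub>0 \<inter> \<theta> B ` U\<^sub>0) \<le> 1"
  \<comment> \<open>The coordinate is \<open>c - c'\<close>: when it vanishes, \<open>A\<close> and
    \<open>B\<close> agree at \<open>j x + c *s z\<close>, which is then 0.\<close>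
  proof (rule dim_le_1I[where P = "\<lambda>u d. \<exists>x\<in>T. \<exists>c c'. u = x + A (j x + c *s z) \<and>
        A (j x + c *s z) = B (j x + c' *s z) \<and> d = c - c'"])
    fix u assume "u \<in> \<theta> A ` U\<^sub>0 \<inter> \<theta> B ` U\<^sub>0"
    then have u: "u \<in> \<theta> A ` U\<^sub>0" "u \<in> \<theta> B ` U\<^sub>0" by auto
    obtain x c where x: "x \<in> T" "u = x + A (j x + c *s z)"
      using u(1) by (rule theta_U)
    obtain y c' where y: "y \<in> T" "u = y + B (j y + c' *s z)"
      using u(2) by (rule theta_U)
    have "x = y" "A (j x + c *s z) = B (j y + c' *s z)"
      using split_eq[OF x(1) y(1) A_K[OF A jzK[OF x(1)]] A_K[OF B jzK[OF y(1)]]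
          trans[OF x(2)[symmetric] y(2)]] by auto
    then show "\<exists>d. \<exists>x\<in>T. \<exists>c c'. u = x + A (j x + c *s z) \<and>
        A (j x + c *s z) = B (j x + c' *s z) \<and> d = c - c'"
      using x by blast
  next
    note l = vec.linear_diff[OF A_lin[OF A]] vec.linear_diff[OF A_lin[OF B]] vec.linear_diff[OF j(1)]
      vec.linear_scale[OF A_lin[OF A]] vec.linear_scale[OF A_lin[OF B]] vec.linear_scale[OF j(1)]
      vec.linear_add[OF A_lin[OF A]] vec.linear_add[OF A_lin[OF B]] vec.linear_add[OF j(1)]
    fix u v d e a
    assume "\<exists>x\<in>T. \<exists>c c'. u = x + A (j x + c *s z) \<and> A (j x + c *s z) = B (j x + c' *s z) \<and> d = c - c'"
      and "\<exists>x\<in>T. \<exists>c c'. v = x + A (j x + c *s z) \<and> A (j x + c *s z) = B (j x + c' *s z) \<and> e = c - c'"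
    then obtain x c c' y b b' where x: "x \<in> T" "u = x + A (j x + c *s z)"
        "A (j x + c *s z) = B (j x + c' *s z)" "d = c - c'"
      and y: "y \<in> T" "v = y + A (j y + b *s z)"
        "A (j y + b *s z) = B (j y + b' *s z)" "e = b - b'"
      by blast
    have eq: "j (x - a *s y) + (c - a * b) *s z = (j x + c *s z) - a *s (j y + b *s z)" for c b
      by (simp add: l algebra_simps vec.scale_right_diff_distrib)
    have 1: "u - a *s v = (x - a *s y) + A (j (x - a *s y) + (c - a * b) *s z)"
      unfolding eq x(2) y(2) l(1) l(4) by (simp add: algebra_simps vec.scale_right_diff_distrib)
    have 2: "A (j (x - a *s y) + (c - a * b) *s z) = B (j (x - a *s y) + (c' - a * b') *s z)"
      unfolding eq l(1,2,4,5) x(3) y(3) ..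
    have 3: "d - a * e = (c - a * b) - (c' - a * b')"
      unfolding x(4) y(4) by (simp add: algebra_simps)
    have 4: "x - a *s y \<in> T"
      using x y subT by (auto intro: vec.subspace_diff vec.subspace_scale)
    show "\<exists>x\<in>T. \<exists>c c'. u - a *s v = x + A (j x + c *s z) \<and>
        A (j x + c *s z) = B (j x + c' *s z) \<and> d - a * e = c - c'"
      using 1 2 3 4 by blast
  next
    fix u assume "\<exists>x\<in>T. \<exists>c c'. u = x + A (j x + c *s z) \<and>
        A (j x + c *s z) = B (j x + c' *s z) \<and> 0 = c - c'"
    then obtain x c where x: "x \<in> T" "u = x + A (j x + c *s z)"
        "A (j x + c *s z) = B (j x + c *s z)"
      by auto
    then have *: "j x + c *s z = 0" using A_diff[OF A B AB jzK] by blast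
    then have "x = 0" using j_eq x by blast
    then show "u = 0" using x * vec.linear_0[OF A_lin[OF A]] by simp
  qed
  moreover have "V \<subseteq> ssum (\<theta> A ` W\<^sub>0) (\<theta> B ` W\<^sub>0)"
  proof (rule V_sub_ssum)
    have sA: "vec.subspace (\<theta> A ` W\<^sub>0)" and sB: "vec.subspace (\<theta> B ` W\<^sub>0)"
      using A B by (auto intro: vec.linear_subspace_image theta_lin subW)
    show sub: "vec.subspace (ssum (\<theta> A ` W\<^sub>0) (\<theta> B ` W\<^sub>0))"
      using sA sB by (rule subspace_ssum)
    show KV: "K \<subseteq> ssum (\<theta> A ` W\<^sub>0) (\<theta> B ` W\<^sub>0)"
    proof
      fix k assume "k \<in> K"
      then obtain h where h: "h \<in> K" "k = A h - B h"
        using spread_set_diff_surj[OF spread A B AB subK] by auto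
      obtain x r where x: "x \<in> T" "r \<in> R" "h = j x + r"
        using h(1) by (rule K_sub_jR)
      \<comment> \<open>The difference of two vectors with the same \<open>x\<close> and
        \<open>r\<close> has no \<open>T\<close> component. This yields \<open>K\<close>, and
        \<open>T\<close> follows modulo \<open>K\<close>.\<close>
      have "k = (x + A (j x + r)) + (- (x + B (j x + r)))"
        using h x by simp
      moreover have "- (x + B (j x + r)) \<in> \<theta> B ` W\<^sub>0"
        using sB theta_W[OF x(1,2)] by (rule vec.subspace_neg)
      ultimately show "k \<in> ssum (\<theta> A ` W\<^sub>0) (\<theta> B ` W\<^sub>0)"
        using theta_W[OF x(1,2)] ssumI by metis
    qed
    show "T \<subseteq> ssum (\<theta> A ` W\<^sub>0) (\<theta> B ` W\<^sub>0)"
    proof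
      fix x assume x: "x \<in> T"
      have "x + A (j x + 0) \<in> ssum (\<theta> A ` W\<^sub>0) (\<theta> B ` W\<^sub>0)"
        using theta_W[OF x vec.subspace_0[OF subR(1)]] ssum_superset(1)[OF sA sB] by auto
      moreover have "A (j x + 0) \<in> ssum (\<theta> A ` W\<^sub>0) (\<theta> B ` W\<^sub>0)"
        using KV A_K[OF A] j x by auto
      ultimately have "(x + A (j x + 0)) - A (j x + 0) \<in> ssum (\<theta> A ` W\<^sub>0) (\<theta> B ` W\<^sub>0)"
        by (rule vec.subspace_diff[OF sub])
      then show "x \<in> ssum (\<theta> A ` W\<^sub>0) (\<theta> B ` W\<^sub>0)" by simp
    qed
  qed
  ultimately show ?thesis by (simp add: triple_compat_def graph_triple_def)
qed

text \<open>The transformed \<open>W\<^sub>0\<close> contains vectors with any prescribed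
  \<open>T\<close> component and vectors with any prescribed \<open>K\<close> component. Whichever
  of \<open>T\<close> and \<open>K\<close> lies in \<open>W\<close> removes the other
  component.\<close>

lemma V_sub_graph_W:
  assumes A: "A \<in> \<A>" and W: "vec.subspace W" "T \<subseteq> W \<or> K \<subseteq> W"
  shows "V \<subseteq> ssum W (\<theta> A ` W\<^sub>0)"
proof (rule V_sub_ssum)
  have sA: "vec.subspace (\<theta> A ` W\<^sub>0)"
    using A by (auto intro: vec.linear_subspace_image theta_lin subW)
  show sub: "vec.subspace (ssum W (\<theta> A ` W\<^sub>0))"
    using W(1) sA by (rule subspace_ssum)
  note sup = ssum_superset[OF W(1) sA]
  have "x \<in> ssum W (\<theta> A ` W\<^sub>0) \<and> k \<in> ssum W (\<theta> A ` W\<^sub>0)" if xk: "x \<in> T" "k \<in> K" for x k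
  proof -
    have 1: "A (j x) \<in> K" "x + A (j x) \<in> \<theta> A ` W\<^sub>0"
      using xk(1) A_K[OF A] j theta_W[of x 0 A] vec.subspace_0[OF subR(1)] by auto
    have "k \<in> A ` K" using xk spread_set_surj[OF spread A subK] by simp
    then obtain h where h: "h \<in> K" "k = A h" by auto
    obtain y r where y: "y \<in> T" "r \<in> R" "h = j y + r"
      using h(1) by (rule K_sub_jR)
    have 2: "y + k \<in> \<theta> A ` W\<^sub>0" using theta_W[OF y(1,2), of A] h y by simp
    from W(2) show ?thesis
    proof
      assume T: "T \<subseteq> W"
      have "y + k - y \<in> ssum W (\<theta> A ` W\<^sub>0)"
        by (rule vec.subspace_diff[OF sub]) (use 2 sup T y in auto)
      then show ?thesis using sup T xk by auto
    next
      assume K: "K \<subseteq> W"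
      have "x + A (j x) - A (j x) \<in> ssum W (\<theta> A ` W\<^sub>0)"
        by (rule vec.subspace_diff[OF sub]) (use 1 sup K in auto)
      then show ?thesis using sup K xk by auto
    qed
  qed
  then show "T \<subseteq> ssum W (\<theta> A ` W\<^sub>0)" "K \<subseteq> ssum W (\<theta> A ` W\<^sub>0)"
    using vec.subspace_0[OF subT] vec.subspace_0[OF subK] by auto
qed

text \<open>A vector of \<open>K\<close> has zero \<open>T\<close> component, which leaves only
  multiples of \<open>A z\<close>.\<close>

lemma dim_graph_U_le:
  assumes A: "A \<in> \<A>" and U: "U \<subseteq> K"
  shows "vec.dim (U \<inter> \<theta> A ` U\<^sub>0) \<le> 1"
proof (rule dim_le_1I_span)
  show "U \<inter> \<theta> A ` U\<^sub>0 \<subseteq> vec.span {A z}"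
  proof
    fix u assume "u \<in> U \<inter> \<theta> A ` U\<^sub>0"
    then have u: "u \<in> K" "u \<in> \<theta> A ` U\<^sub>0" using U by auto
    obtain x c where x: "x \<in> T" "u = x + A (j x + c *s z)"
      using u(2) by (rule theta_U)
    have "x + A (j x + c *s z) = 0 + u" using x by simp
    then have "x = 0" "A (j x + c *s z) = u"
      using split_eq[OF x(1) vec.subspace_0[OF subT] A_K[OF A jzK[OF x(1)]] u(1)] by auto
    then have "u = c *s A z"
      using vec.linear_0[OF j(1)] vec.linear_scale[OF A_lin[OF A]] by simp
    then show "u \<in> vec.span {A z}" by (auto simp: vec.span_singleton)
  qed
qed

lemma dim_origin_U_le:
  assumes U: "U \<subseteq> K"
  shows "vec.dim (U \<inter> U\<^sub>0) \<le> 1"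
proof (rule dim_le_1I_span)
  show "U \<inter> U\<^sub>0 \<subseteq> vec.span {z}"
  proof
    fix u assume "u \<in> U \<inter> U\<^sub>0"
    then obtain x c where x: "u \<in> K" "x \<in> T" "u = x + c *s z"
      using U by (auto simp: U_iff)
    have "c *s z \<in> K" using zK subK by (rule vec.subspace_scale[rotated])
    moreover have "x + c *s z = 0 + u" using x by simp
    ultimately have "x = 0"
      using split_eq(1)[OF x(2) vec.subspace_0[OF subT] _ x(1)] by blast
    then show "u \<in> vec.span {z}" using x by (auto simp: vec.span_singleton)
  qed
qed

lemma compat_origin_graph:
  assumes A: "A \<in> \<A>"
  shows "triple_compat V origin_triple (graph_triple A)"
proof -
  have "v = 0" if v: "v \<in> T" "v \<in> \<theta> A ` T" for v
  proof -
    obtain x where x: "x \<in> T" "v = x + A (j x)"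
      using v(2) by (rule theta_T)
    have "v + 0 = x + A (j x)" using x by simp
    then have "A (j x) = 0" "v = x"
      using split_eq[of v x 0 "A (j x)"] v x A_K[OF A] j(2) vec.subspace_0[OF subK] by auto
    then have "j x = 0" using A_zero[OF A] j x by blast
    then show ?thesis using j_eq[of x 0] x \<open>v = x\<close> by simp
  qed
  moreover have "vec.dim (U\<^sub>0 \<inter> \<theta> A ` U\<^sub>0) \<le> 1"
  \<comment> \<open>The coordinate is the coefficient \<open>d\<close> of \<open>z\<close>: if it
    vanishes, \<open>A\<close> kills \<open>j x + c *s z\<close>, which forces
    \<open>x = 0\<close>.\<close>
  proof (rule dim_le_1I[where P = "\<lambda>u d. \<exists>x\<in>T. \<exists>c. u = x + d *s z \<and> A (j x + c *s z) = d *s z"])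
    fix u assume "u \<in> U\<^sub>0 \<inter> \<theta> A ` U\<^sub>0"
    then have u: "u \<in> U\<^sub>0" "u \<in> \<theta> A ` U\<^sub>0" by auto
    obtain x c where x: "x \<in> T" "u = x + A (j x + c *s z)"
      using u(2) by (rule theta_U)
    obtain y d where y: "y \<in> T" "u = y + d *s z"
      using u(1) by (auto simp: U_iff)
    have "d *s z \<in> K" using zK subK by (rule vec.subspace_scale[rotated])
    then have "x = y" "A (j x + c *s z) = d *s z"
      using split_eq[OF x(1) y(1) A_K[OF A jzK[OF x(1)]] _ trans[OF x(2)[symmetric] y(2)]] by auto
    then show "\<exists>d. \<exists>x\<in>T. \<exists>c. u = x + d *s z \<and> A (j x + c *s z) = d *s z"
      using y x(1) by blast
  next
    note l = vec.linear_diff[OF A_lin[OF A]] vec.linear_diff[OF j(1)]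
      vec.linear_scale[OF A_lin[OF A]] vec.linear_scale[OF j(1)]
      vec.linear_add[OF A_lin[OF A]] vec.linear_add[OF j(1)]
    fix u v d e a
    assume "\<exists>x\<in>T. \<exists>c. u = x + d *s z \<and> A (j x + c *s z) = d *s z"
      and "\<exists>x\<in>T. \<exists>c. v = x + e *s z \<and> A (j x + c *s z) = e *s z"
    then obtain x c y b where x: "x \<in> T" "u = x + d *s z" "A (j x + c *s z) = d *s z"
      and y: "y \<in> T" "v = y + e *s z" "A (j y + b *s z) = e *s z"
      by blast
    have eq: "j (x - a *s y) + (c - a * b) *s z = (j x + c *s z) - a *s (j y + b *s z)"
      by (simp add: l algebra_simps vec.scale_right_diff_distrib)
    have 1: "u - a *s v = (x - a *s y) + (d - a * e) *s z"
      unfolding x(2) y(2) by (simp add: algebra_simps vec.scale_right_diff_distrib)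
    have 2: "A (j (x - a *s y) + (c - a * b) *s z) = (d - a * e) *s z"
      unfolding eq l(1,3) x(3) y(3) by (simp add: algebra_simps)
    have 3: "x - a *s y \<in> T"
      using x y subT by (auto intro: vec.subspace_diff vec.subspace_scale)
    show "\<exists>x\<in>T. \<exists>c. u - a *s v = x + (d - a * e) *s z \<and> A (j x + c *s z) = (d - a * e) *s z"
      using 1 2 3 by blast
  next
    fix u assume "\<exists>x\<in>T. \<exists>c. u = x + 0 *s z \<and> A (j x + c *s z) = 0 *s z"
    then obtain x c where x: "x \<in> T" "u = x" "A (j x + c *s z) = 0"
      by auto
    then show "u = 0" using A_zero[OF A jzK] j_eq by blast
  qed
  moreover have "V \<subseteq> ssum W\<^sub>0 (\<theta> A ` W\<^sub>0)"
    using T_sub_W by (intro V_sub_graph_W A subW) auto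
  ultimately show ?thesis
    by (auto simp: triple_compat_def origin_triple_def graph_triple_def)
qed

text \<open>The hypotheses collect what depends on how the triples of \<open>\<H>\<close> were
  formed, so that the extension step and the base in dimension \<open>3 t\<close> share this
  argument.\<close>

lemma extend_family:
  assumes fam: "triple_family (vec.dim T) V \<H>" and fin: "finite \<H>" "finite \<A>"
    and S: "\<And>S U W. (S, U, W) \<in> \<H> \<Longrightarrow> S \<subseteq> K"
    and UA: "\<And>S U W A. (S, U, W) \<in> \<H> \<Longrightarrow> A \<in> \<A> \<Longrightarrow> vec.dim (U \<inter> \<theta> A ` U\<^sub>0) \<le> 1"
    and U0: "\<And>S U W. (S, U, W) \<in> \<H> \<Longrightarrow> vec.dim (U \<inter> U\<^sub>0) \<le> 1"
    and W: "\<And>S U W. (S, U, W) \<in> \<H> \<Longrightarrow> (T \<subseteq> W \<or> K \<subseteq> W) \<and> K \<subseteq> ssum W R"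
  shows "triple_family (vec.dim T) V (\<H> \<union> insert origin_triple (graph_triple ` \<A>))"
    and "card (\<H> \<union> insert origin_triple (graph_triple ` \<A>)) = card \<H> + 1 + card \<A>"
proof -
  have trip: "is_triple (vec.dim T) V h" if "h \<in> \<H>" for h
    using fam that by (auto simp: triple_family_def)
  have hg: "triple_compat V h (graph_triple A)" if h: "h \<in> \<H>" and A: "A \<in> \<A>" for h A
  proof -
    obtain S' U' W' where h': "h = (S', U', W')" by (cases h)
    have "S' \<inter> \<theta> A ` T \<subseteq> {0}"
    proof
      fix v assume "v \<in> S' \<inter> \<theta> A ` T"
      then have v: "v \<in> K" "v \<in> \<theta> A ` T" using S h h' by auto
      obtain x where x: "x \<in> T" "v = x + A (j x)"
        using v(2) by (rule theta_T)
      have "x + A (j x) = 0 + v" using x by simp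
      then have "x = 0"
        using split_eq(1)[OF x(1) vec.subspace_0[OF subT] A_K[OF A j(2)[OF x(1)]] v(1)] by blast
      then show "v \<in> {0}" using x vec.linear_0[OF j(1)] vec.linear_0[OF A_lin[OF A]] by simp
    qed
    moreover have "V \<subseteq> ssum W' (\<theta> A ` W\<^sub>0)"
      using trip[OF h] W[of S' U' W'] h h' by (intro V_sub_graph_W A) (auto simp: is_triple_def)
    ultimately show ?thesis
      using UA[of S' U' W' A] h A by (simp add: h' triple_compat_def graph_triple_def)
  qed
  have ho: "triple_compat V h origin_triple" if h: "h \<in> \<H>" for h
  proof -
    obtain S' U' W' where h': "h = (S', U', W')" by (cases h)
    have sub: "vec.subspace W'" using trip[OF h] by (auto simp: h' is_triple_def)
    have "V \<subseteq> ssum W' W\<^sub>0"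
    proof (rule V_sub_ssum)
      show "vec.subspace (ssum W' W\<^sub>0)" using sub subW by (rule subspace_ssum)
      show "T \<subseteq> ssum W' W\<^sub>0" using ssum_superset(2)[OF sub subW] T_sub_W by blast
      show "K \<subseteq> ssum W' W\<^sub>0"
        using W[of S' U' W'] h h' ssum_mono[OF subset_refl R_sub_W, of W'] by blast
    qed
    moreover have "S' \<inter> T \<subseteq> {0}" using S[of S' U' W'] h h' TK by auto
    ultimately show ?thesis
      using U0[of S' U' W'] h by (simp add: h' triple_compat_def origin_triple_def)
  qed
  let ?G = "\<H> \<union> insert origin_triple (graph_triple ` \<A>)"
  have "pairwise (triple_compat V) ?G"
  proof (rule pairwiseI)
    fix g g' assume "g \<in> ?G" "g' \<in> ?G" "g \<noteq> g'"
    then consider "g \<in> \<H>" "g' \<in> \<H>" | "g \<in> \<H>" "g' = origin_triple" | "g = origin_triple" "g' \<in> \<H>"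
      | A where "g \<in> \<H>" "A \<in> \<A>" "g' = graph_triple A"
      | A where "g' \<in> \<H>" "A \<in> \<A>" "g = graph_triple A"
      | A where "g = origin_triple" "A \<in> \<A>" "g' = graph_triple A"
      | A where "g' = origin_triple" "A \<in> \<A>" "g = graph_triple A"
      | A B where "A \<in> \<A>" "B \<in> \<A>" "g = graph_triple A" "g' = graph_triple B"
      by blast
    then show "triple_compat V g g'"
    proof cases
      case 1
      then show ?thesis
        using fam \<open>g \<noteq> g'\<close> by (auto simp: triple_family_def dest: pairwiseD)
    next
      case (8 A B)
      then show ?thesis
        using compat_graphs \<open>g \<noteq> g'\<close> by blast
    qed (use ho hg compat_origin_graph compat_sym in blast)+
  qed
  then show "triple_family (vec.dim T) V ?G"
    using trip origin_is_triple graph_is_triple by (auto simp: triple_family_def)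
  have no: "triple_compat V g g' \<Longrightarrow> is_triple (vec.dim T) V g \<Longrightarrow> g \<noteq> g'" for g g'
    using not_compat_self[OF _ dimT] by blast
  have "inj_on graph_triple \<A>"
    using no[OF compat_graphs graph_is_triple] by (intro inj_onI) blast
  then have "card (graph_triple ` \<A>) = card \<A>" by (rule card_image)
  moreover have "origin_triple \<notin> graph_triple ` \<A>"
    using no[OF compat_origin_graph origin_is_triple] by auto
  moreover have "\<H> \<inter> insert origin_triple (graph_triple ` \<A>) = {}"
    using no[OF ho trip] no[OF hg trip] by blast
  ultimately show "card ?G = card \<H> + 1 + card \<A>"
    using fin by (simp add: card_Un_disjoint)
qed

end

section \<open>The extension step\<close>

text \<open>A basis is extended successively from \<open>S\<close> to \<open>U\<close>,
  \<open>W\<close> and \<open>V\<close>, and \<open>f d\<close> is the span of its first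
  \<open>d\<close> vectors.\<close>

lemma complete_chain:
  fixes S U W V :: "('a::field ^ 'n::finite) set"
  assumes sub: "vec.subspace S" "vec.subspace U" "vec.subspace W" "vec.subspace V"
    and incl: "S \<subseteq> U" "U \<subseteq> W" "W \<subseteq> V"
  obtains f where
    "\<And>d. d \<le> vec.dim V \<Longrightarrow> vec.subspace (f d) \<and> vec.dim (f d) = d \<and> f d \<subseteq> V"
    "\<And>d e. d \<le> e \<Longrightarrow> f d \<subseteq> f e"
    "f (vec.dim S) = S" "f (vec.dim U) = U" "f (vec.dim W) = W"
proof -
  define basis_list where
    "basis_list bs D \<longleftrightarrow> distinct bs \<and> vec.independent (set bs) \<and> vec.span (set bs) = D" for bs and D :: "('a ^ 'n) set"
  have len: "length bs = vec.dim D" if "basis_list bs D" for bs D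
    using that vec.dim_span_eq_card_independent[of "set bs"]
    by (auto simp: basis_list_def distinct_card)
  have ext: "\<exists>cs. basis_list (bs @ cs) E" if bs: "basis_list bs D" "D \<subseteq> E" "vec.subspace E" for bs D E
  proof -
    have "set bs \<subseteq> E"
      using bs vec.span_superset[of "set bs"] by (auto simp: basis_list_def)
    then obtain C where C: "set bs \<subseteq> C" "C \<subseteq> E" "vec.independent C" "E \<subseteq> vec.span C"
      using vec.maximal_independent_subset_extend[of "set bs" E] bs(1) by (auto simp: basis_list_def)
    have "finite (C - set bs)" using vec.finiteI_independent[OF C(3)] by simp
    then obtain cs where cs: "set cs = C - set bs" "distinct cs"
      using finite_distinct_list by blast
    have "vec.span C = E" using C bs(3) vec.span_minimal by blast
    moreover have "set (bs @ cs) = C" using cs(1) C(1) by auto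
    moreover have "distinct (bs @ cs)" using cs bs(1) by (auto simp: basis_list_def)
    ultimately show ?thesis using C(3) unfolding basis_list_def by metis
  qed
  have "basis_list [] {0}"
    using vec.independent_empty by (simp add: basis_list_def)
  then obtain bS where S: "basis_list bS S"
    using ext[of "[]" "{0}" S] sub vec.subspace_0 by (metis append_Nil empty_subsetI insert_subset)
  then obtain bU where U: "basis_list (bS @ bU) U" using ext sub incl by blast
  then obtain bW where W: "basis_list ((bS @ bU) @ bW) W" using ext sub incl by blast
  then obtain bV where V: "basis_list (((bS @ bU) @ bW) @ bV) V" using ext sub incl by blast
  define bs where "bs = ((bS @ bU) @ bW) @ bV"
  define f where "f d = vec.span (set (take d bs))" for d
  have bs: "distinct bs" "vec.independent (set bs)" "vec.span (set bs) = V" "length bs = vec.dim V"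
    using V len[OF V] by (auto simp: bs_def basis_list_def)
  have f1: "vec.subspace (f d) \<and> vec.dim (f d) = d \<and> f d \<subseteq> V" if d: "d \<le> vec.dim V" for d
  proof -
    have "vec.independent (set (take d bs))"
      by (rule vec.independent_mono[OF bs(2) set_take_subset])
    then have "vec.dim (f d) = card (set (take d bs))"
      unfolding f_def by (rule vec.dim_span_eq_card_independent)
    also have "\<dots> = d" using bs d by (simp add: distinct_card)
    finally show ?thesis
      using bs(3) vec.span_mono[OF set_take_subset, of d bs] by (simp add: f_def)
  qed
  have f2: "f d \<subseteq> f e" if "d \<le> e" for d e
    unfolding f_def using that by (intro vec.span_mono set_take_subset_set_take)
  have f3: "f (vec.dim S) = S" "f (vec.dim U) = U" "f (vec.dim W) = W"
    using S U W len[OF S] len[OF U] len[OF W] unfolding f_def bs_def basis_list_def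
    by (auto simp del: append_assoc)
  show thesis using that f1 f2 f3 by blast
qed

text \<open>The input of the extension step. For the distinguished triple, inclusion is weakened to
  a common nonzero vector; this suffices because the step replaces its \<open>W\<^sub>0\<close> by
  \<open>K\<close>.\<close>

definition weak_family where
  "weak_family t K N \<longleftrightarrow> (\<exists>\<G> S\<^sub>0 U\<^sub>0 W\<^sub>0 z. triple_family t K \<G> \<and> card \<G> = N \<and> (S\<^sub>0, U\<^sub>0, W\<^sub>0) \<in> \<G> \<and>
     z \<in> U\<^sub>0 \<inter> W\<^sub>0 \<and> z \<noteq> 0 \<and> (\<forall>S U W. (S, U, W) \<in> \<G> - {(S\<^sub>0, U\<^sub>0, W\<^sub>0)} \<longrightarrow> U \<subseteq> W))"

text \<open>The output of the extension step. The pair meeting in dimension exactly 1 keeps the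
  minimum distance from exceeding the maximum minus 2.\<close>

definition strong_family where
  "strong_family t V N \<longleftrightarrow> (\<exists>\<G>. triple_family t V \<G> \<and> card \<G> = N \<and>
     (\<forall>S U W. (S, U, W) \<in> \<G> \<longrightarrow> U \<subseteq> W) \<and>
     (\<exists>S U W S' U' W'. (S, U, W) \<in> \<G> \<and> (S', U', W') \<in> \<G> \<and> (S, U, W) \<noteq> (S', U', W') \<and>
        vec.dim (U \<inter> U') = 1))"

text \<open>Any triple can be distinguished, with \<open>z\<close> a nonzero vector of
  \<open>S\<close>.\<close>

lemma strong_imp_weak:
  assumes "strong_family t V N" "t \<noteq> 0"
  shows "weak_family t V N"
proof -
  obtain \<G> S U W where G: "triple_family t V \<G>" "card \<G> = N" "(S, U, W) \<in> \<G>"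
    "\<forall>S U W. (S, U, W) \<in> \<G> \<longrightarrow> U \<subseteq> W"
    using assms(1) unfolding strong_family_def by blast
  have S: "vec.dim S = t" "S \<subseteq> U" "U \<subseteq> W" 
    using G by (auto simp: triple_family_def is_triple_def)
  then have "\<not> S \<subseteq> {0}" using assms(2) vec.dim_eq_0 by metis
  then obtain z where "z \<in> S" "z \<noteq> 0" by auto
  then show ?thesis
    unfolding weak_family_def using G S by blast
qed

text \<open>\<open>W\<close> has only dimension \<open>r\<close> and may be too small to contain
  \<open>U\<close>. With all members taken from one chain they still share the line
  \<open>f 1\<close>, provided \<open>r \<noteq> 0\<close>.\<close>

lemma weak_family_base:
  fixes K :: "('a::{field,finite} ^ 'n::finite) set"
  assumes K: "vec.subspace K" "vec.dim K = t + r" and "r \<noteq> 0"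
  shows "weak_family t K 1"
proof -
  have "{0} \<subseteq> K" using vec.subspace_0[OF K(1)] by simp
  then obtain f where f': "\<And>d. d \<le> vec.dim K \<Longrightarrow> vec.subspace (f d) \<and> vec.dim (f d) = d \<and> f d \<subseteq> K"
    "\<And>d e. d \<le> e \<Longrightarrow> f d \<subseteq> f e"
    using complete_chain[OF vec.subspace_single_0 vec.subspace_single_0 vec.subspace_single_0 K(1)
        subset_refl subset_refl] by metis
  note f = f'[unfolded K(2)]
  have "vec.dim (f 1) = 1" using f(1)[of 1] assms(3) by simp
  then have "\<not> f 1 \<subseteq> {0}" using vec.dim_eq_0 by (metis zero_neq_one)
  then obtain z where z: "z \<in> f 1" "z \<noteq> 0" by auto
  have "is_triple t K (f t, f (t + 1), f r)"
    using f(1)[of t] f(1)[of "t + 1"] f(1)[of r] f(2)[of t "t + 1"] K assms(3) by (auto simp: is_triple_def)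
  then have "triple_family t K {(f t, f (t + 1), f r)}"
    by (simp add: triple_family_def)
  moreover have "z \<in> f (t + 1) \<inter> f r"
    using z f(2)[of 1 "t + 1"] f(2)[of 1 r] assms(3) by auto
  ultimately show ?thesis
    unfolding weak_family_def using z(2) by (intro exI[of _ "{(f t, f (t + 1), f r)}"]) auto
qed

text \<open>The count consists of \<open>N\<close> lifted triples, the origin triple and
  \<open>q ^ s - 1\<close> graph triples.\<close>

lemma extension_step:
  fixes V :: "('a::{field,finite} ^ 'n::finite) set"
  assumes V: "vec.subspace V" "vec.dim V = s + t" and st: "t \<noteq> 0" "t \<le> s"
    and weak: "\<And>K :: ('a ^ 'n) set. vec.subspace K \<Longrightarrow> vec.dim K = s \<Longrightarrow> weak_family t K N"
  shows "strong_family t V (N + CARD('a) ^ s)"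
proof -
  obtain K where K: "vec.subspace K" "K \<subseteq> V" "vec.dim K = s"
    using vec.choose_subspace_of_subspace[of s V] V by (auto simp: vec.span_eq_iff[THEN iffD2])
  obtain T p where T: "vec.subspace T" "T \<subseteq> V" "vec.dim V = vec.dim T + vec.dim K"
    and p: "Vector_Spaces.linear (*s) (*s) p" "\<And>x. x \<in> T \<Longrightarrow> p x = x" "\<And>x. x \<in> K \<Longrightarrow> p x = 0"
    and TK: "T \<inter> K \<subseteq> {0}" "ssum T K = V"
    using complement_projection[OF K(1,2) V(1)] by metis
  have dT: "vec.dim T = t" using T(3) V(2) K(3) by simp
  obtain \<G> S\<^sub>1 U\<^sub>1 W\<^sub>1 z where w: "triple_family t K \<G> \<and> card \<G> = N \<and>
      (S\<^sub>1, U\<^sub>1, W\<^sub>1) \<in> \<G> \<and> z \<in> U\<^sub>1 \<inter> W\<^sub>1 \<and> z \<noteq> 0 \<and>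
      (\<forall>S U W. (S, U, W) \<in> \<G> - {(S\<^sub>1, U\<^sub>1, W\<^sub>1)} \<longrightarrow> U \<subseteq> W)"
    using weak[OF K(1,3)] unfolding weak_family_def by (elim exE) (rule that)
  then have G: "triple_family t K \<G>" "card \<G> = N" and 1: "(S\<^sub>1, U\<^sub>1, W\<^sub>1) \<in> \<G>"
    and z: "z \<in> U\<^sub>1" "z \<in> W\<^sub>1" "z \<noteq> 0"
    by simp_all
  have UW: "U \<subseteq> W" if "(S, U, W) \<in> \<G>" "(S, U, W) \<noteq> (S\<^sub>1, U\<^sub>1, W\<^sub>1)" for S U W
    using w that by blast
  have tr: "vec.subspace S" "vec.subspace U" "vec.subspace W" "S \<subseteq> U" "U \<subseteq> K" "W \<subseteq> K"
    "vec.dim S = t" "vec.dim U = t + 1" "vec.dim W + t = s" if "(S, U, W) \<in> \<G>" for S U W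
    using that G(1) K(3) by (auto simp: triple_family_def is_triple_def)
  have cp: "S \<inter> S' \<subseteq> {0}" "vec.dim (U \<inter> U') \<le> 1" "K \<subseteq> ssum W W'"
    if "(S, U, W) \<in> \<G>" "(S', U', W') \<in> \<G>" "(S, U, W) \<noteq> (S', U', W')" for S U W S' U' W'
    using G(1) that unfolding triple_family_def pairwise_def triple_compat_def by fastforce+
  note W1 = tr[OF 1]
  \<comment> \<open>A complement of \<open>W\<^sub>1\<close> in \<open>K\<close> has dimension
    \<open>t\<close>, so \<open>T\<close> can be mapped onto it by \<open>j\<close>.\<close>
  obtain J where J: "vec.subspace J" "J \<subseteq> K" "vec.dim K = vec.dim J + vec.dim W\<^sub>1" "J \<inter> W\<^sub>1 \<subseteq> {0}"
    using complement_projection[OF W1(3,6) K(1)] by metis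
  have "vec.dim T = vec.dim J" using J(3) W1(9) K(3) dT by simp
  then obtain j where j: "Vector_Spaces.linear (*s) (*s) j" "j ` T = J" "inj_on j T"
    using vec.subspace_isomorphism[OF T(1) J(1)] by blast
  have j0: "x = 0" if "x \<in> T" "j x \<in> W\<^sub>1" for x
  proof -
    have "j x = 0" using that j(2) J(4) by auto
    then show ?thesis
      using that(1) j(3) vec.linear_inj_on_iff_eq_0[OF j(1) T(1)] by blast
  qed
  obtain \<A> where A: "spread_set K \<A>" "card \<A> = CARD('a) ^ s - 1"
  proof (rule spread_set_and_spread[of K 1 s])
    show "vec.subspace K" "vec.dim K = 1 * s" "1 * s \<noteq> 0"
      using K st by simp_all
  next
    fix \<A> :: "('a ^ 'n \<Rightarrow> 'a ^ 'n) set"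
    assume "spread_set K \<A>" "card \<A> = CARD('a) ^ (1 * s) - 1"
    then show thesis using that by simp
  qed
  interpret ts: twisted_sum T K W\<^sub>1 p j z \<A>
  proof
    show "vec.dim K = vec.dim T + vec.dim W\<^sub>1" "vec.dim T \<noteq> 0"
      using W1(9) K(3) dT st(1) by linarith+
    show "j x \<in> K" if "x \<in> T" for x
      using that j(2) J(2) by blast
  qed (erule (1) j0 | erule p(2) p(3) | rule vec.linear_add[OF p(1)] vec.linear_scale[OF p(1)]
      vec.linear_add[OF j(1)] vec.linear_scale[OF j(1)] T(1) K(1) W1(3) W1(6) z(2) z(3) A(1))+
  have V_eq: "ts.V = V" using TK(2) by (simp add: ts.V_def)
  \<comment> \<open>The old \<open>W\<close> have dimension \<open>s - t\<close>, but
    \<open>s\<close> is now required. Adding \<open>T\<close> achieves this; the distinguished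
    triple gets \<open>K\<close> instead, which contains \<open>U\<^sub>1\<close> in any
    case.\<close>
  define lift where "lift = (\<lambda>(S, U, W). (S, U, if (S, U, W) = (S\<^sub>1, U\<^sub>1, W\<^sub>1) then K else ssum T W))"
  define \<H> where "\<H> = lift ` \<G>"
  have inH: "(S, U, W) \<in> \<H> \<longleftrightarrow> (\<exists>W'. (S, U, W') \<in> \<G> \<and>
      W = (if (S, U, W') = (S\<^sub>1, U\<^sub>1, W\<^sub>1) then K else ssum T W'))" for S U W
  proof
    assume "(S, U, W) \<in> \<H>"
    then obtain S' U' W' where "(S', U', W') \<in> \<G>" "(S, U, W) = lift (S', U', W')"
      unfolding \<H>_def by (elim imageE) (metis prod_cases3)
    then show "\<exists>W'. (S, U, W') \<in> \<G> \<and>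
        W = (if (S, U, W') = (S\<^sub>1, U\<^sub>1, W\<^sub>1) then K else ssum T W')"
      by (intro exI[of _ W']) (simp add: lift_def)
  next
    assume "\<exists>W'. (S, U, W') \<in> \<G> \<and>
        W = (if (S, U, W') = (S\<^sub>1, U\<^sub>1, W\<^sub>1) then K else ssum T W')"
    then obtain W' where "(S, U, W') \<in> \<G>" "(S, U, W) = lift (S, U, W')"
      unfolding lift_def prod.case by blast
    then show "(S, U, W) \<in> \<H>"
      unfolding \<H>_def by blast
  qed
  have trW: "vec.subspace W" "W \<subseteq> V" "vec.dim W = s" "T \<subseteq> W \<or> K \<subseteq> W" if "(S, U, W) \<in> \<H>" for S U W
  proof -
    obtain W' where W': "(S, U, W') \<in> \<G>" "W = (if (S, U, W') = (S\<^sub>1, U\<^sub>1, W\<^sub>1) then K else ssum T W')"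
      using \<open>(S, U, W) \<in> \<H>\<close> inH by blast
    note t = tr[OF W'(1)]
    have "T \<inter> W' \<subseteq> {0}" using t TK(1) by blast
    then have "vec.dim (ssum T W') = s" using dim_ssum[OF T(1) t(3)] dT t(9) by simp
    moreover have "ssum T W' \<subseteq> V" using T t K by (intro ssum_least V) auto
    ultimately show "vec.subspace W" "W \<subseteq> V" "vec.dim W = s" "T \<subseteq> W \<or> K \<subseteq> W"
      using W'(2) K T subspace_ssum[OF T(1) t(3)] ssum_superset[OF T(1) t(3)] by auto
  qed
  have sumW: "V \<subseteq> ssum (if (S, U, W) = (S\<^sub>1, U\<^sub>1, W\<^sub>1) then K else ssum T W)
      (if (S', U', W') = (S\<^sub>1, U\<^sub>1, W\<^sub>1) then K else ssum T W')" (is "V \<subseteq> ssum ?L ?L'")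
    if *: "(S, U, W) \<in> \<G>" "(S', U', W') \<in> \<G>" "(S, U, W) \<noteq> (S', U', W')" for S U W S' U' W'
  proof -
    note W = tr(3)[OF *(1)] tr(3)[OF *(2)]
    have L: "vec.subspace ?L" "vec.subspace ?L'"
      using W K(1) subspace_ssum[OF T(1)] by auto
    note supL = ssum_superset[OF L]
    note supT = ssum_superset[OF T(1) W(1)] ssum_superset[OF T(1) W(2)]
    \<comment> \<open>At most one of the two triples is distinguished, so \<open>T\<close> lies in
      the large member of another; \<open>K\<close> is either one of the large members or covered by
      the old sum of \<open>W\<close> and \<open>W'\<close>.\<close>
    have "(S, U, W) \<noteq> (S\<^sub>1, U\<^sub>1, W\<^sub>1) \<or> (S', U', W') \<noteq> (S\<^sub>1, U\<^sub>1, W\<^sub>1)"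
      using *(3) by metis
    moreover have "T \<subseteq> ?L" "W \<subseteq> ?L" if "(S, U, W) \<noteq> (S\<^sub>1, U\<^sub>1, W\<^sub>1)"
      unfolding if_not_P[OF that] by (rule supT)+
    moreover have "T \<subseteq> ?L'" "W' \<subseteq> ?L'" if "(S', U', W') \<noteq> (S\<^sub>1, U\<^sub>1, W\<^sub>1)"
      unfolding if_not_P[OF that] by (rule supT)+
    moreover have "K \<subseteq> ?L" if "(S, U, W) = (S\<^sub>1, U\<^sub>1, W\<^sub>1)"
      unfolding if_P[OF that] by (rule subset_refl)
    moreover have "K \<subseteq> ?L'" if "(S', U', W') = (S\<^sub>1, U\<^sub>1, W\<^sub>1)"
      unfolding if_P[OF that] by (rule subset_refl)
    ultimately have incl: "T \<subseteq> ?L \<or> T \<subseteq> ?L'"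
        "K \<subseteq> ?L \<or> K \<subseteq> ?L' \<or> (W \<subseteq> ?L \<and> W' \<subseteq> ?L')"
      by argo+
    from incl(1) have "T \<subseteq> ssum ?L ?L'" using supL by blast
    moreover from incl(2) have "K \<subseteq> ssum ?L ?L'"
      using supL cp(3)[OF *] ssum_mono[of W ?L W' ?L'] by blast
    ultimately show ?thesis
      unfolding TK(2)[symmetric] using subspace_ssum[OF L] by (intro ssum_least)
  qed
  have famH: "triple_family t V \<H>"
    unfolding triple_family_def
  proof (intro conjI ballI pairwiseI)
    fix g assume g: "g \<in> \<H>"
    obtain S U W where SUW: "g = (S, U, W)" by (cases g)
    then obtain W' where W': "(S, U, W') \<in> \<G>" using g inH by blast
    show "is_triple t V g"
      using tr[OF W'] trW[OF g[unfolded SUW]] K(2) V(2) by (auto simp: SUW is_triple_def)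
  next
    fix g g' assume "g \<in> \<H>" "g' \<in> \<H>" "g \<noteq> g'"
    then obtain h h' where h: "h \<in> \<G>" "h' \<in> \<G>" "h \<noteq> h'" "g = lift h" "g' = lift h'"
      unfolding \<H>_def by (elim imageE) metis
    obtain S U W where SUW: "h = (S, U, W)" by (cases h)
    obtain S' U' W' where SUW': "h' = (S', U', W')" by (cases h')
    note * = h(1)[unfolded SUW] h(2)[unfolded SUW'] h(3)[unfolded SUW SUW']
    show "triple_compat V g g'"
      unfolding h(4,5) SUW SUW' lift_def triple_compat_def prod.case
      using cp(1,2)[OF *] sumW[OF *] by blast
  qed
  have "inj_on lift \<G>"
  proof (rule inj_onI, rule ccontr)
    fix h h' assume h: "h \<in> \<G>" "h' \<in> \<G>" "lift h = lift h'" "h \<noteq> h'"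
    obtain S U W where SUW: "h = (S, U, W)" by (cases h)
    obtain S' U' W' where SUW': "h' = (S', U', W')" by (cases h')
    note * = h(1)[unfolded SUW] h(2)[unfolded SUW'] h(4)[unfolded SUW SUW']
    have "S = S'" using h(3) by (simp add: SUW SUW' lift_def)
    then have "S \<subseteq> {0}" using cp(1)[OF *] by simp
    then have "vec.dim S = 0" by simp
    then show False using tr(7)[OF *(1)] st(1) by linarith
  qed
  then have cardH: "card \<H> = N"
    unfolding \<H>_def using G(2) by (simp add: card_image)
  have fam: "triple_family (vec.dim T) ts.V \<H>" using famH by (simp add: V_eq dT)
  note ext = ts.extend_family[OF fam]
  let ?G = "\<H> \<union> insert ts.origin_triple (ts.graph_triple ` \<A>)"
  have UK: "U \<subseteq> K" if "(S, U, W) \<in> \<H>" for S U W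
    using that tr(5) unfolding inH by blast
  have hyps: "finite \<H>" "finite \<A>"
    "\<And>S U W. (S, U, W) \<in> \<H> \<Longrightarrow> S \<subseteq> K"
    "\<And>S U W A. (S, U, W) \<in> \<H> \<Longrightarrow> A \<in> \<A> \<Longrightarrow> vec.dim (U \<inter> ts.\<theta> A ` ts.U\<^sub>0) \<le> 1"
    "\<And>S U W. (S, U, W) \<in> \<H> \<Longrightarrow> vec.dim (U \<inter> ts.U\<^sub>0) \<le> 1"
    "\<And>S U W. (S, U, W) \<in> \<H> \<Longrightarrow> (T \<subseteq> W \<or> K \<subseteq> W) \<and> K \<subseteq> ssum W W\<^sub>1"
  proof -
    show "finite \<H>" "finite \<A>" by simp_all
  next
    fix S U W assume g: "(S, U, W) \<in> \<H>"
    obtain W' where W': "(S, U, W') \<in> \<G>" "W = (if (S, U, W') = (S\<^sub>1, U\<^sub>1, W\<^sub>1) then K else ssum T W')"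
      using g inH by blast
    show "S \<subseteq> K" using tr(4,5)[OF W'(1)] by blast
    show "vec.dim (U \<inter> ts.U\<^sub>0) \<le> 1" by (rule ts.dim_origin_U_le[OF UK[OF g]])
    show "vec.dim (U \<inter> ts.\<theta> A ` ts.U\<^sub>0) \<le> 1" if "A \<in> \<A>" for A
      by (rule ts.dim_graph_U_le[OF that UK[OF g]])
    have "K \<subseteq> ssum W W\<^sub>1"
    proof (cases "(S, U, W') = (S\<^sub>1, U\<^sub>1, W\<^sub>1)")
      case True
      then show ?thesis using W'(2) ssum_superset(1)[OF K(1) W1(3)] by simp
    next
      case False
      then show ?thesis
        using W'(2) cp(3)[OF W'(1) 1 False] ssum_superset(2)[OF T(1) tr(3)[OF W'(1)]]
          ssum_mono[of W' "ssum T W'" W\<^sub>1 W\<^sub>1] by auto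
    qed
    then show "(T \<subseteq> W \<or> K \<subseteq> W) \<and> K \<subseteq> ssum W W\<^sub>1"
      using trW(4)[OF g] by blast
  qed
  have G': "triple_family t V ?G" "card ?G = N + 1 + card \<A>"
    using ext[OF hyps] by (simp_all add: V_eq dT cardH)
  have "card ?G = N + CARD('a) ^ s"
    using G'(2) A(2) by simp
  moreover have "U \<subseteq> W" if g: "(S, U, W) \<in> ?G" for S U W
  proof -
    from g consider "(S, U, W) \<in> \<H>" | "(S, U, W) = ts.origin_triple"
      | A where "(S, U, W) = ts.graph_triple A" by blast
    then show ?thesis
    proof cases
      case 1
      then obtain W' where W': "(S, U, W') \<in> \<G>"
          "W = (if (S, U, W') = (S\<^sub>1, U\<^sub>1, W\<^sub>1) then K else ssum T W')"
        using inH by blast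
      show ?thesis
        using W'(2) UW[OF W'(1)] tr(5)[OF W'(1)] ssum_superset(2)[OF T(1) tr(3)[OF W'(1)]]
        by (simp split: if_splits) blast
    qed (use ts.U_sub_W in \<open>auto simp: ts.origin_triple_def ts.graph_triple_def\<close>)
  qed
  moreover have "\<exists>S U W S' U' W'. (S, U, W) \<in> ?G \<and> (S', U', W') \<in> ?G \<and> (S, U, W) \<noteq> (S', U', W') \<and>
        vec.dim (U \<inter> U') = 1"
  proof -
    have H1: "(S\<^sub>1, U\<^sub>1, K) \<in> \<H>" using 1 inH by auto
    have "S\<^sub>1 \<noteq> T"
    proof
      assume "S\<^sub>1 = T"
      then have "T \<subseteq> {0}" using W1(4,5) TK(1) by blast
      then have "vec.dim T = 0" by simp
      then show False using dT st(1) by linarith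
    qed
    then have "(S\<^sub>1, U\<^sub>1, K) \<noteq> (T, ts.U\<^sub>0, ts.W\<^sub>0)" by simp
    \<comment> \<open>\<open>z\<close> lies in \<open>U\<^sub>1\<close> and in the new
      \<open>U\<^sub>0\<close>, so the bound 1 is attained.\<close>
    moreover have "vec.dim (U\<^sub>1 \<inter> ts.U\<^sub>0) = 1"
      using hyps(5)[OF H1] dim_ge_1I[of z "U\<^sub>1 \<inter> ts.U\<^sub>0"] z ts.z_in_U by simp
    ultimately show ?thesis
      using H1 unfolding ts.origin_triple_def by blast
  qed
  ultimately show ?thesis
    unfolding strong_family_def using G'(1) by blast
qed

section \<open>Ambient dimension 3t\<close>

lemma subspace_diff_scale:
  "vec.subspace D \<Longrightarrow> u \<in> D \<Longrightarrow> v \<in> D \<Longrightarrow> u - c *s v \<in> D"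
  by (rule vec.subspace_diff[OF _ _ vec.subspace_scale])

text \<open>The spread partitions the nonzero vectors of \<open>K\<close>, so with
  \<open>Q = q ^ t\<close> the count is \<open>Q * Q - 1\<close> divided by
  \<open>Q - 1\<close>.\<close>

lemma card_spread:
  fixes K :: "('a::{field,finite} ^ 'n::finite) set"
  assumes K: "vec.subspace K" "vec.dim K = t + t" "t \<noteq> 0"
    and S: "\<And>S. S \<in> \<S> \<Longrightarrow> vec.subspace S \<and> S \<subseteq> K \<and> vec.dim S = t"
    and int: "\<And>S S'. S \<in> \<S> \<Longrightarrow> S' \<in> \<S> \<Longrightarrow> S \<noteq> S' \<Longrightarrow> S \<inter> S' = {0}"
    and un: "\<Union>\<S> = K"
  shows "card \<S> = CARD('a) ^ t + 1"
proof -
  let ?Q = "CARD('a) ^ t"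
  have Q: "?Q \<ge> 2"
    using card_field_ge_2[where ?'a='a] self_le_power[of "CARD('a)" t] K(3) by simp
  have "card (\<Union>S\<in>\<S>. S - {0}) = (\<Sum>S\<in>\<S>. card (S - {0}))"
    using int by (intro card_UN_disjoint) auto
  also have "\<dots> = (\<Sum>S\<in>\<S>. ?Q - 1)"
  proof (rule sum.cong)
    fix D assume "D \<in> \<S>"
    then have "vec.subspace D" "vec.dim D = t" using S by auto
    then show "card (D - {0}) = ?Q - 1"
      by (simp add: card_Diff_subset vec.subspace_0 card_subspace)
  qed simp
  also have "(\<Union>S\<in>\<S>. S - {0}) = K - {0}"
    using un by auto
  also have "card (K - {0}) = ?Q * ?Q - 1"
    using K by (simp add: card_Diff_subset vec.subspace_0 card_subspace power_add)
  finally have "card \<S> * (?Q - 1) = ?Q * ?Q - 1" by simp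
  also have "\<dots> = (?Q + 1) * (?Q - 1)"
    using Q by (simp add: algebra_simps)
  finally have "card \<S> * (?Q - 1) = (?Q + 1) * (?Q - 1)" .
  moreover have "?Q - 1 \<noteq> 0" using Q by linarith
  ultimately show ?thesis unfolding mult_cancel2 by blast
qed

text \<open>In dimension \<open>2 t\<close> two spaces of dimension \<open>t + 1\<close> meet in
  dimension at least 2, so at most one \<open>U\<close> can stay inside \<open>K\<close>. The others
  leave \<open>K\<close> through a common vector \<open>w\<close> of \<open>T\<close>.\<close>

lemma strong_family_base:
  fixes V :: "('a::{field,finite} ^ 'n::finite) set"
  assumes V: "vec.subspace V" "vec.dim V = (t + t) + t" and t: "t \<noteq> 0"
  shows "strong_family t V (1 + CARD('a) ^ t + CARD('a) ^ (t + t))"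
proof -
  obtain K where K: "vec.subspace K" "K \<subseteq> V" "vec.dim K = t + t"
    using vec.choose_subspace_of_subspace[of "t + t" V] V by (auto simp: vec.span_eq_iff[THEN iffD2])
  obtain T p where T: "vec.subspace T" "T \<subseteq> V" "vec.dim V = vec.dim T + vec.dim K"
    and p: "Vector_Spaces.linear (*s) (*s) p" "\<And>x. x \<in> T \<Longrightarrow> p x = x" "\<And>x. x \<in> K \<Longrightarrow> p x = 0"
    and TK: "T \<inter> K \<subseteq> {0}" "ssum T K = V"
    using complement_projection[OF K(1,2) V(1)] by metis
  have dT: "vec.dim T = t" using T(3) V(2) K(3) by simp
  obtain \<A> \<S> where A: "spread_set K \<A>" "card \<A> = CARD('a) ^ (t + t) - 1"
    and S: "\<And>S. S \<in> \<S> \<Longrightarrow> vec.subspace S \<and> S \<subseteq> K \<and> vec.dim S = t"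
    and int: "\<And>S S'. S \<in> \<S> \<Longrightarrow> S' \<in> \<S> \<Longrightarrow> S \<noteq> S' \<Longrightarrow> S \<inter> S' = {0}"
    and un: "\<Union>\<S> = K"
    and AS: "\<And>A S. A \<in> \<A> \<Longrightarrow> S \<in> \<S> \<Longrightarrow> A ` S \<in> \<S>"
  proof (rule spread_set_and_spread[of K t 2])
    show "vec.subspace K" "vec.dim K = t * 2" "t * 2 \<noteq> 0" using K t by simp_all
  next
    fix \<A> :: "('a ^ 'n \<Rightarrow> 'a ^ 'n) set" and \<S>
    assume "spread_set K \<A>" "card \<A> = CARD('a) ^ (t * 2) - 1"
      "\<And>S. S \<in> \<S> \<Longrightarrow> vec.subspace S \<and> S \<subseteq> K \<and> vec.dim S = t"
      "\<And>S S'. S \<in> \<S> \<Longrightarrow> S' \<in> \<S> \<Longrightarrow> S \<noteq> S' \<Longrightarrow> S \<inter> S' = {0}"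
      "\<Union>\<S> = K"
      "\<And>A S. A \<in> \<A> \<Longrightarrow> S \<in> \<S> \<Longrightarrow> A ` S \<in> \<S>"
    then show thesis using that[of \<A> \<S>] by (simp add: mult_2_right)
  qed
  have cS: "card \<S> = CARD('a) ^ t + 1"
    by (rule card_spread[OF K(1,3) t S int un])
  have nz: "\<exists>x\<in>D. x \<noteq> 0" if "vec.dim D = t" for D :: "('a ^ 'n) set"
  proof (rule ccontr)
    assume "\<not> (\<exists>x\<in>D. x \<noteq> 0)"
    then have "D \<subseteq> {0}" by auto
    then have "vec.dim D = 0" by simp
    then show False using that t by linarith
  qed
  have "1 < card \<S>" unfolding cS by simp
  then obtain S\<^sub>0 S\<^sub>1 where S01: "S\<^sub>0 \<in> \<S>" "S\<^sub>1 \<in> \<S>" "S\<^sub>0 \<noteq> S\<^sub>1"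
    by (metis card_le_Suc0_iff_eq finite linorder_not_less One_nat_def)
  note S0 = S[OF S01(1)] and S1 = S[OF S01(2)]
  have S01_int: "S\<^sub>0 \<inter> S\<^sub>1 = {0}" by (rule int[OF S01])
  obtain z where z: "z \<in> S\<^sub>0" "z \<noteq> 0" using nz S0 by blast
  obtain y where y: "y \<in> S\<^sub>1" "y \<noteq> 0" using nz S1 by blast
  obtain w where w: "w \<in> T" "w \<noteq> 0" using nz[OF dT] by blast
  have "vec.dim T = vec.dim S\<^sub>1" using dT S1 by simp
  then obtain j where j: "Vector_Spaces.linear (*s) (*s) j" "j ` T = S\<^sub>1" "inj_on j T"
    using vec.subspace_isomorphism[OF T(1), of S\<^sub>1] S1 by blast
  have jT0: "x = 0" if "x \<in> T" "j x = 0" for x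
    using that j(3) vec.linear_inj_on_iff_eq_0[OF j(1) T(1)] by blast
  interpret ts: twisted_sum T K S\<^sub>0 p j z \<A>
  proof
    show "vec.subspace S\<^sub>0" "S\<^sub>0 \<subseteq> K" using S0 by blast+
    show "vec.dim K = vec.dim T + vec.dim S\<^sub>0" "vec.dim T \<noteq> 0"
      using S0 K(3) dT t by linarith+
    show "j x \<in> K" if "x \<in> T" for x
      using that j(2) S1 by blast
    show "x = 0" if "x \<in> T" "j x \<in> S\<^sub>0" for x
      using that jT0[of x] j(2) S01_int by blast
  qed (erule p(2) p(3) | rule vec.linear_add[OF p(1)] vec.linear_scale[OF p(1)]
      vec.linear_add[OF j(1)] vec.linear_scale[OF j(1)] T(1) K(1) z A(1))+
  have V_eq: "ts.V = V" using TK(2) by (simp add: ts.V_def)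
  have wK: "w \<notin> K" using w TK(1) by blast
  have y0: "y \<notin> S\<^sub>0" using y S01_int by blast
  define top where "top S = (if S = S\<^sub>0 then (vec.span (insert y S), K) else (vec.span (insert w S), ssum T S))" for S
  define \<H> where "\<H> = (\<lambda>S. (S, top S)) ` \<S>"
  have span: "u \<in> vec.span (insert v D) \<longleftrightarrow> (\<exists>c. u - c *s v \<in> D)" if "vec.subspace D" for u v and D :: "('a ^ 'n) set"
    using that by (simp add: vec.span_insert vec.span_eq_iff[THEN iffD2])
  have sup: "D \<subseteq> vec.span (insert v D)" for v and D :: "('a ^ 'n) set"
    by (meson subset_insertI subset_trans vec.span_superset)
  have SS: "ssum S S' = K" if "S \<in> \<S>" "S' \<in> \<S>" "S \<noteq> S'" for S S'
    using S[OF that(1)] S[OF that(2)] int[OF that] K by (intro ssum_eqI) auto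
  have Uw: "vec.dim (vec.span (insert w S)) = t + 1" if "S \<in> \<S>" for S
    using S[OF that] wK by (auto simp: vec.dim_insert vec.span_eq_iff[THEN iffD2])
  have Uy: "vec.dim (vec.span (insert y S\<^sub>0)) = t + 1" "vec.span (insert y S\<^sub>0) \<subseteq> K"
  proof -
    show "vec.dim (vec.span (insert y S\<^sub>0)) = t + 1"
      using S0 y0 by (simp add: vec.dim_insert vec.span_eq_iff[THEN iffD2])
    show "vec.span (insert y S\<^sub>0) \<subseteq> K"
      using y S0 S1 by (intro vec.span_minimal K) auto
  qed
  have TS: "vec.subspace (ssum T S)" "T \<subseteq> ssum T S" "S \<subseteq> ssum T S" "vec.dim (ssum T S) = t + t"
      "ssum T S \<subseteq> V" "vec.span (insert w S) \<subseteq> ssum T S" if "S \<in> \<S>" for S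
  proof -
    have s: "vec.subspace S" "S \<subseteq> K" "vec.dim S = t" using S[OF that] by auto
    show 1: "vec.subspace (ssum T S)" "T \<subseteq> ssum T S" "S \<subseteq> ssum T S"
      using subspace_ssum[OF T(1) s(1)] ssum_superset[OF T(1) s(1)] by auto
    have "T \<inter> S \<subseteq> {0}" using TK(1) s by blast
    then show "vec.dim (ssum T S) = t + t" using dim_ssum[OF T(1) s(1)] dT s by simp
    show "ssum T S \<subseteq> V" using s K(2) by (intro ssum_least T(2) V(1)) auto
    show "vec.span (insert w S) \<subseteq> ssum T S"
      using 1 w by (intro vec.span_minimal) auto
  qed
  have famH: "triple_family t V \<H>"
    unfolding triple_family_def
  proof (intro conjI ballI pairwiseI)
    fix h assume "h \<in> \<H>"
    then obtain S' where h: "S' \<in> \<S>" "h = (S', top S')" by (auto simp: \<H>_def)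
    show "is_triple t V h"
    proof (cases "S' = S\<^sub>0")
      case True
      then show ?thesis
        using h S0 Uy sup[of S\<^sub>0 y] K V by (auto simp: top_def is_triple_def)
    next
      case False
      then show ?thesis
        using h S[OF h(1)] Uw[OF h(1)] TS[OF h(1)] sup[of S' w] V by (auto simp: top_def is_triple_def)
    qed
  next
    have special: "triple_compat V (S', top S') (S\<^sub>0, top S\<^sub>0)" if S': "S' \<in> \<S>" "S' \<noteq> S\<^sub>0" for S'
    proof -
      note s = S[OF S'(1)]
      have "vec.dim (vec.span (insert w S') \<inter> vec.span (insert y S\<^sub>0)) \<le> 1"
      \<comment> \<open>The second space lies in \<open>K\<close>, so \<open>w\<close> cannot occur
        and \<open>u \<in> S'\<close>. The coordinate is the coefficient of \<open>y\<close>; if it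
        is 0, then \<open>u\<close> lies in two spread elements.\<close>
      proof (rule dim_le_1I[where P = "\<lambda>u d. u \<in> S' \<and> u - d *s y \<in> S\<^sub>0"])
        fix u assume "u \<in> vec.span (insert w S') \<inter> vec.span (insert y S\<^sub>0)"
        then obtain c d where u: "u - c *s w \<in> S'" "u - d *s y \<in> S\<^sub>0" "u \<in> K"
          using span[of S' u w] span[of S\<^sub>0 u y] s S0 Uy(2) by auto
        have "c *s w \<in> K"
          using vec.subspace_diff[OF K(1) u(3), of "u - c *s w"] u(1) s by auto
        then have "c = 0"
          using vec.subspace_scale[OF K(1), of "c *s w" "inverse c"] wK by (cases "c = 0") auto
        then show "\<exists>d. u \<in> S' \<and> u - d *s y \<in> S\<^sub>0" using u by auto
      next
        fix u v d e c assume 1: "u \<in> S' \<and> u - d *s y \<in> S\<^sub>0" and 2: "v \<in> S' \<and> v - e *s y \<in> S\<^sub>0"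
        have eq: "u - c *s v - (d - c * e) *s y = (u - d *s y) - c *s (v - e *s y)"
          by (simp add: algebra_simps vec.scale_right_diff_distrib)
        show "u - c *s v \<in> S' \<and> u - c *s v - (d - c * e) *s y \<in> S\<^sub>0"
          unfolding eq using 1 2 s S0 by (blast intro: subspace_diff_scale)
      next
        fix u assume "u \<in> S' \<and> u - 0 *s y \<in> S\<^sub>0"
        then show "u = 0" using int[OF S'(1) S01(1) S'(2)] by auto
      qed
      moreover have "V \<subseteq> ssum (ssum T S') K"
        using ssum_mono[OF TS(2)[OF S'(1)] subset_refl, of K] TK(2) by simp
      ultimately show ?thesis
        using S' int[OF S'(1) S01(1) S'(2)] by (simp add: top_def triple_compat_def)
    qed
    have generic: "triple_compat V (S', top S') (S'', top S'')"
      if S': "S' \<in> \<S>" "S' \<noteq> S\<^sub>0" and S'': "S'' \<in> \<S>" "S'' \<noteq> S\<^sub>0" and ne: "S' \<noteq> S''" for S' S''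
    proof -
      note s = S[OF S'(1)] S[OF S''(1)]
      have "vec.span (insert w S') \<inter> vec.span (insert w S'') \<subseteq> vec.span {w}"
      proof
        fix u assume "u \<in> vec.span (insert w S') \<inter> vec.span (insert w S'')"
        then obtain c d where u: "u - c *s w \<in> S'" "u - d *s w \<in> S''"
          using span[of S' u w] span[of S'' u w] s by auto
        \<comment> \<open>No nonzero multiple of \<open>w\<close> lies in \<open>K\<close>, so the
          two coefficients of \<open>w\<close> agree and \<open>u - c *s w\<close> lies in both
          spread elements.\<close>
        have "(u - c *s w) - (u - d *s w) \<in> K"
          by (rule vec.subspace_diff[OF K(1)]) (use u s in auto)
        moreover have "(u - c *s w) - (u - d *s w) = (d - c) *s w"
          by (simp add: algebra_simps)
        ultimately have "(d - c) *s w \<in> K" by simp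
        then have "d = c"
          using vec.subspace_scale[OF K(1), of "(d - c) *s w" "inverse (d - c)"] wK by (cases "d = c") auto
        then have "u - c *s w \<in> S' \<inter> S''" using u by simp
        then have "u - c *s w = 0" using int[OF S'(1) S''(1) ne] by blast
        then show "u \<in> vec.span {w}" by (auto simp: vec.span_singleton)
      qed
      then have "vec.dim (vec.span (insert w S') \<inter> vec.span (insert w S'')) \<le> 1"
        by (rule dim_le_1I_span)
      moreover have "V \<subseteq> ssum (ssum T S') (ssum T S'')"
      proof -
        note tt = TS(1)[OF S'(1)] TS(1)[OF S''(1)]
        have "T \<subseteq> ssum (ssum T S') (ssum T S'')"
          using TS(2)[OF S'(1)] ssum_superset(1)[OF tt] by blast
        moreover have "K \<subseteq> ssum (ssum T S') (ssum T S'')"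
          using SS[OF S'(1) S''(1) ne] ssum_mono[OF TS(3)[OF S'(1)] TS(3)[OF S''(1)]] by simp
        ultimately show ?thesis
          unfolding TK(2)[symmetric] using subspace_ssum[OF tt] by (intro ssum_least)
      qed
      ultimately show ?thesis
        using S' S'' int[OF S'(1) S''(1) ne] by (simp add: top_def triple_compat_def)
    qed
    fix h h' assume "h \<in> \<H>" "h' \<in> \<H>" "h \<noteq> h'"
    then obtain S' S'' where h: "S' \<in> \<S>" "h = (S', top S')" "S'' \<in> \<S>" "h' = (S'', top S'')" "S' \<noteq> S''"
      by (auto simp: \<H>_def)
    show "triple_compat V h h'"
    proof (cases "S' = S\<^sub>0")
      case True
      then show ?thesis using special[of S''] h compat_sym by metis
    next
      case False
      then show ?thesis using special[of S'] generic[of S' S''] h by metis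
    qed
  qed
  have cardH: "card \<H> = CARD('a) ^ t + 1"
    unfolding \<H>_def cS[symmetric] by (rule card_image) (auto intro: inj_onI)
  have inH: "\<exists>S'\<in>\<S>. S = S' \<and> ((S = S\<^sub>0 \<and> U = vec.span (insert y S\<^sub>0) \<and> W = K) \<or>
      (S \<noteq> S\<^sub>0 \<and> U = vec.span (insert w S) \<and> W = ssum T S))" if "(S, U, W) \<in> \<H>" for S U W
    using that by (auto simp: \<H>_def top_def split: if_splits)
  have fam: "triple_family (vec.dim T) ts.V \<H>" using famH by (simp add: V_eq dT)
  note ext = ts.extend_family[OF fam]
  let ?G = "\<H> \<union> insert ts.origin_triple (ts.graph_triple ` \<A>)"
  have graph_int: "vec.dim (vec.span (insert w S') \<inter> ts.\<theta> A ` ts.U\<^sub>0) \<le> 1"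
    if S': "S' \<in> \<S>" "S' \<noteq> S\<^sub>0" and AA: "A \<in> \<A>" for S' A
  proof -
    note s = S[OF S'(1)]
    note linA = ts.A_lin[OF AA]
    have AS0: "A ` S\<^sub>0 \<in> \<S>" by (rule AS[OF AA S01(1)])
    \<comment> \<open>Comparing \<open>T\<close> components gives \<open>x = c *s w\<close>, so
      \<open>u\<close> is determined by the two scalars \<open>c\<close> and
      \<open>d\<close>.\<close>
    have u_ex: "\<exists>c d. u - c *s w \<in> S' \<and> u - c *s w = A (c *s j w + d *s z)"
      if u: "u \<in> vec.span (insert w S')" "u \<in> ts.\<theta> A ` ts.U\<^sub>0" for u
    proof -
      obtain c where c: "u - c *s w \<in> S'" using span[of S' u w] s u(1) by blast
      obtain x d where x: "x \<in> T" "u = x + A (j x + d *s z)"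
        using u(2) by (rule ts.theta_U)
      have cw: "c *s w \<in> T" using w(1) T(1) by (intro vec.subspace_scale)
      have "c *s w + (u - c *s w) = x + A (j x + d *s z)" using x by simp
      then have "c *s w = x" "u - c *s w = A (j x + d *s z)"
        using ts.split_eq[OF cw x(1) _ ts.A_K[OF AA ts.jzK[OF x(1)]]] c s by blast+
      then have "u - c *s w = A (c *s j w + d *s z)"
        using vec.linear_scale[OF j(1), of c w] by metis
      then show ?thesis using c by blast
    qed
    show ?thesis
    proof (cases "A ` S\<^sub>0 = S'")
      case True
      \<comment> \<open>Pulling back along \<open>A\<close> puts \<open>c *s j w + d *s z\<close>
        into \<open>S\<^sub>0\<close>. Then \<open>c *s j w\<close> lies in
        \<open>S\<^sub>0 \<inter> S\<^sub>1\<close>, so \<open>c = 0\<close>.\<close>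
      have "vec.span (insert w S') \<inter> ts.\<theta> A ` ts.U\<^sub>0 \<subseteq> vec.span {A z}"
      proof
        fix u assume u: "u \<in> vec.span (insert w S') \<inter> ts.\<theta> A ` ts.U\<^sub>0"
        then obtain c d where c: "u - c *s w \<in> S'" "u - c *s w = A (c *s j w + d *s z)"
          using u_ex by blast
        obtain v where v: "v \<in> S\<^sub>0" "A v = A (c *s j w + d *s z)"
          using c True by (metis imageE)
        have jw: "j w \<in> S\<^sub>1" using j(2) w(1) by blast
        have "c *s j w + d *s z - v \<in> K"
          by (intro vec.subspace_diff[OF K(1)] vec.subspace_add[OF K(1)] vec.subspace_scale[OF K(1)])
            (use jw v(1) z(1) S0 S1 in auto)
        moreover have "A (c *s j w + d *s z - v) = 0"
          using v(2) vec.linear_diff[OF linA] by simp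
        ultimately have "c *s j w + d *s z - v = 0" using ts.A_zero[OF AA] by blast
        then have "c *s j w = v - d *s z" by (simp add: algebra_simps)
        moreover have "v - d *s z \<in> S\<^sub>0"
          using v(1) z(1) S0 by (intro vec.subspace_diff vec.subspace_scale) auto
        moreover have "c *s j w \<in> S\<^sub>1" using jw S1 by (intro vec.subspace_scale) auto
        ultimately have "c *s j w \<in> S\<^sub>0 \<inter> S\<^sub>1" by simp
        then have "c *s j w = 0" using S01_int by blast
        moreover have "j w \<noteq> 0" using jT0 w by blast
        ultimately have "c = 0" by simp
        then have "u = d *s A z" using c(2) vec.linear_scale[OF linA] by simp
        then show "u \<in> vec.span {A z}" by (auto simp: vec.span_singleton)
      qed
      then show ?thesis by (rule dim_le_1I_span)
    next
      case False
      show ?thesis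
      \<comment> \<open>Now \<open>c\<close> is the coordinate. If it is 0, the vector lies in
        \<open>S'\<close> and in the image of \<open>S\<^sub>0\<close> under \<open>A\<close>, which
        is a different spread element.\<close>
      proof (rule dim_le_1I[where P = "\<lambda>u c. u - c *s w \<in> S' \<and> (\<exists>d. u - c *s w = A (c *s j w + d *s z))"])
        fix u assume "u \<in> vec.span (insert w S') \<inter> ts.\<theta> A ` ts.U\<^sub>0"
        then show "\<exists>c. u - c *s w \<in> S' \<and> (\<exists>d. u - c *s w = A (c *s j w + d *s z))"
          using u_ex by blast
      next
        fix u v d e c
        assume 1: "u - d *s w \<in> S' \<and> (\<exists>a. u - d *s w = A (d *s j w + a *s z))"
          and 2: "v - e *s w \<in> S' \<and> (\<exists>a. v - e *s w = A (e *s j w + a *s z))"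
        obtain a b where a: "u - d *s w = A (d *s j w + a *s z)" and b: "v - e *s w = A (e *s j w + b *s z)"
          using 1 2 by blast
        have eq: "u - c *s v - (d - c * e) *s w = (u - d *s w) - c *s (v - e *s w)"
          by (simp add: algebra_simps vec.scale_right_diff_distrib)
        have "u - c *s v - (d - c * e) *s w \<in> S'"
          unfolding eq using 1 2 s by (blast intro: subspace_diff_scale)
        moreover have "(d - c * e) *s j w + (a - c * b) *s z = (d *s j w + a *s z) - c *s (e *s j w + b *s z)"
          by (simp add: algebra_simps vec.scale_right_diff_distrib)
        then have "u - c *s v - (d - c * e) *s w = A ((d - c * e) *s j w + (a - c * b) *s z)"
          unfolding eq a b by (simp add: vec.linear_diff[OF linA] vec.linear_scale[OF linA])
        ultimately show "u - c *s v - (d - c * e) *s w \<in> S' \<and>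
            (\<exists>a. u - c *s v - (d - c * e) *s w = A ((d - c * e) *s j w + a *s z))"
          by blast
      next
        fix u assume "u - 0 *s w \<in> S' \<and> (\<exists>d. u - 0 *s w = A (0 *s j w + d *s z))"
        then obtain d where d: "u \<in> S'" "u = A (d *s z)" by auto
        have "d *s z \<in> S\<^sub>0" using z(1) S0 by (intro vec.subspace_scale) auto
        then have "u \<in> A ` S\<^sub>0" using d(2) by blast
        then show "u = 0" using int[OF AS0 S'(1) False] d(1) by blast
      qed
    qed
  qed
  have origin_int: "vec.dim (vec.span (insert w S') \<inter> ts.U\<^sub>0) \<le> 1"
    if S': "S' \<in> \<S>" "S' \<noteq> S\<^sub>0" for S'
  proof (rule dim_le_1I_span)
    note s = S[OF S'(1)]
    show "vec.span (insert w S') \<inter> ts.U\<^sub>0 \<subseteq> vec.span {w}"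
    proof
      fix u assume u: "u \<in> vec.span (insert w S') \<inter> ts.U\<^sub>0"
      then obtain c where c: "u - c *s w \<in> S'" using span[of S' u w] s by blast
      obtain x d where x: "x \<in> T" "u = x + d *s z" using u ts.U_iff by blast
      have cw: "c *s w \<in> T" using w(1) T(1) by (intro vec.subspace_scale)
      have dz: "d *s z \<in> S\<^sub>0" using z(1) S0 by (intro vec.subspace_scale) auto
      have "c *s w + (u - c *s w) = x + d *s z" using x by simp
      \<comment> \<open>The \<open>K\<close> component lies in both \<open>S'\<close> and
        \<open>S\<^sub>0\<close>, hence vanishes.\<close>
      then have "u - c *s w = d *s z"
        using ts.split_eq(2)[OF cw x(1)] c s dz S0 by blast
      then have "u - c *s w \<in> S' \<inter> S\<^sub>0" using c dz by simp
      then have "u - c *s w = 0" using int[OF S'(1) S01(1) S'(2)] by blast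
      then show "u \<in> vec.span {w}" by (auto simp: vec.span_singleton)
    qed
  qed
  have hyps: "finite \<H>" "finite \<A>"
    "\<And>S U W. (S, U, W) \<in> \<H> \<Longrightarrow> S \<subseteq> K"
    "\<And>S U W A. (S, U, W) \<in> \<H> \<Longrightarrow> A \<in> \<A> \<Longrightarrow> vec.dim (U \<inter> ts.\<theta> A ` ts.U\<^sub>0) \<le> 1"
    "\<And>S U W. (S, U, W) \<in> \<H> \<Longrightarrow> vec.dim (U \<inter> ts.U\<^sub>0) \<le> 1"
    "\<And>S U W. (S, U, W) \<in> \<H> \<Longrightarrow> (T \<subseteq> W \<or> K \<subseteq> W) \<and> K \<subseteq> ssum W S\<^sub>0"
  proof -
    show "finite \<H>" "finite \<A>" by simp_all
  next
    fix S' U W assume "(S', U, W) \<in> \<H>"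
    then have h: "S' \<in> \<S>" "(S' = S\<^sub>0 \<and> U = vec.span (insert y S\<^sub>0) \<and> W = K) \<or>
      (S' \<noteq> S\<^sub>0 \<and> U = vec.span (insert w S') \<and> W = ssum T S')"
      using inH by blast+
    show "S' \<subseteq> K" using S[OF h(1)] by blast
    show "vec.dim (U \<inter> ts.\<theta> A ` ts.U\<^sub>0) \<le> 1" if "A \<in> \<A>" for A
      using h(2) graph_int[OF h(1) _ that] ts.dim_graph_U_le[OF that Uy(2)] by blast
    show "vec.dim (U \<inter> ts.U\<^sub>0) \<le> 1"
      using h(2) origin_int[OF h(1)] ts.dim_origin_U_le[OF Uy(2)] by blast
    have "K \<subseteq> ssum K S\<^sub>0"
      using ssum_superset(1)[OF K(1)] S0 by blast
    moreover have "K \<subseteq> ssum (ssum T S') S\<^sub>0" if "S' \<noteq> S\<^sub>0"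
      using SS[OF h(1) S01(1) that] ssum_mono[OF TS(3)[OF h(1)], of S\<^sub>0 S\<^sub>0] by simp
    ultimately show "(T \<subseteq> W \<or> K \<subseteq> W) \<and> K \<subseteq> ssum W S\<^sub>0"
      using h(2) TS(2)[OF h(1)] by blast
  qed
  have G': "triple_family t V ?G" "card ?G = CARD('a) ^ t + 1 + 1 + card \<A>"
    using ext[OF hyps] by (simp_all add: V_eq dT cardH)
  have "card ?G = 1 + CARD('a) ^ t + CARD('a) ^ (t + t)"
    using G'(2) A(2) by simp
  moreover have "U \<subseteq> W" if g: "(S, U, W) \<in> ?G" for S U W
  proof -
    from g consider "(S, U, W) \<in> \<H>" | "(S, U, W) = ts.origin_triple"
      | A where "(S, U, W) = ts.graph_triple A" by blast
    then show ?thesis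
    proof cases
      case 1
      then show ?thesis using inH[of S U W] Uy(2) TS(6) by blast
    qed (use ts.U_sub_W in \<open>auto simp: ts.origin_triple_def ts.graph_triple_def\<close>)
  qed
  moreover have "\<exists>S U W S' U' W'. (S, U, W) \<in> ?G \<and> (S', U', W') \<in> ?G \<and> (S, U, W) \<noteq> (S', U', W') \<and>
        vec.dim (U \<inter> U') = 1"
  proof -
    have H1: "(S\<^sub>0, vec.span (insert y S\<^sub>0), K) \<in> \<H>" using S01 by (auto simp: \<H>_def top_def)
    have "w \<notin> S\<^sub>0" using wK S0 by blast
    then have "(S\<^sub>0, vec.span (insert y S\<^sub>0), K) \<noteq> (T, ts.U\<^sub>0, ts.W\<^sub>0)" using w by auto
    moreover have "vec.dim (vec.span (insert y S\<^sub>0) \<inter> ts.U\<^sub>0) = 1"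
      using hyps(5)[OF H1] dim_ge_1I[of z "vec.span (insert y S\<^sub>0) \<inter> ts.U\<^sub>0"] z ts.z_in_U sup[of S\<^sub>0 y] by force
    ultimately show ?thesis
      using H1 unfolding ts.origin_triple_def by blast
  qed
  ultimately show ?thesis
    unfolding strong_family_def using G'(1) by blast
qed

section \<open>The flag code\<close>

text \<open>Induction on \<open>M\<close>, each extension from dimension \<open>d\<close> to
  \<open>d + t\<close> adding \<open>q ^ d\<close> triples. It starts at \<open>M = 1\<close> for
  \<open>r \<noteq> 0\<close> and at \<open>M = 2\<close>, that is in dimension \<open>3 t\<close>,
  for \<open>r = 0\<close>.\<close>

lemma strong_family_exists:
  fixes V :: "('a::{field,finite} ^ 'n::finite) set"
  assumes t: "t \<noteq> 0" and M: "r \<noteq> 0 \<and> M \<ge> 1 \<or> r = 0 \<and> M \<ge> 2"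
    and V: "vec.subspace V" "vec.dim V = (t + r + M * t)"
  shows "strong_family t V (1 + (\<Sum>i<M. CARD('a) ^ (t + r + i * t)))"
proof -
  define P where "P M \<longleftrightarrow> (\<forall>V :: ('a ^ 'n) set. vec.subspace V \<longrightarrow> vec.dim V = t + r + M * t \<longrightarrow>
      strong_family t V (1 + (\<Sum>i<M. CARD('a) ^ (t + r + i * t))))" for M
  have step: "P (Suc m)" if "P m" for m
    unfolding P_def
  proof (intro allI impI)
    fix V :: "('a ^ 'n) set" assume V: "vec.subspace V" "vec.dim V = t + r + Suc m * t"
    have d: "vec.dim V = (t + r + m * t) + t" using V(2) by simp
    have "strong_family t V ((1 + (\<Sum>i<m. CARD('a) ^ (t + r + i * t))) + CARD('a) ^ (t + r + m * t))"
    proof (rule extension_step[OF V(1) d t])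
      show "t \<le> t + r + m * t" by simp
      fix K :: "('a ^ 'n) set" assume "vec.subspace K" "vec.dim K = t + r + m * t"
      then show "weak_family t K (1 + (\<Sum>i<m. CARD('a) ^ (t + r + i * t)))"
        using \<open>P m\<close> strong_imp_weak[OF _ t] unfolding P_def by blast
    qed
    then show "strong_family t V (1 + (\<Sum>i<Suc m. CARD('a) ^ (t + r + i * t)))"
      by (simp add: add.assoc)
  qed
  have "P M"
  proof (cases "r = 0")
    case False
    have "P 1"
      unfolding P_def
    proof (intro allI impI)
      fix V :: "('a ^ 'n) set" assume V: "vec.subspace V" "vec.dim V = t + r + 1 * t"
      have d: "vec.dim V = (t + r) + t" using V(2) by simp
      have "strong_family t V (1 + CARD('a) ^ (t + r))"
        by (rule extension_step[OF V(1) d t]) (use weak_family_base False in auto)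
      then show "strong_family t V (1 + (\<Sum>i<1. CARD('a) ^ (t + r + i * t)))" by simp
    qed
    have "1 \<le> M" using M False by simp
    then show ?thesis
      by (induction rule: nat_induct_at_least) (use \<open>P 1\<close> step in blast)+
  next
    case True
    have "P 2"
      unfolding P_def
    proof (intro allI impI)
      fix V :: "('a ^ 'n) set" assume V: "vec.subspace V" "vec.dim V = t + r + 2 * t"
      have d: "vec.dim V = (t + t) + t" using V(2) True by simp
      have "strong_family t V (1 + CARD('a) ^ t + CARD('a) ^ (t + t))"
        by (rule strong_family_base[OF V(1) d t])
      then show "strong_family t V (1 + (\<Sum>i<2. CARD('a) ^ (t + r + i * t)))"
        using True by (simp add: numeral_2_eq_2 add.assoc)
    qed
    have "2 \<le> M" using M True by simp
    then show ?thesis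
      by (induction rule: nat_induct_at_least) (use \<open>P 2\<close> step in blast)+
  qed
  then show ?thesis using V by (simp add: P_def)
qed

text \<open>There are finitely many lists of sets of a given length, so the maximum is over a finite
  set.\<close>

lemma A_star_ge:
  fixes C :: "('a::{field,finite} ^ 'n::finite) set list set"
  assumes "aodfc (sorted_list_of_set D) C"
  shows "card C \<le> A_star TYPE('a ^ 'n) D"
proof -
  let ?L = "{F :: ('a ^ 'n) set list. set F \<subseteq> UNIV \<and> length F = length (sorted_list_of_set D)}"
  have "{card C | C :: ('a ^ 'n) set list set. aodfc (sorted_list_of_set D) C} \<subseteq> card ` Pow ?L"
    by (auto simp: aodfc_def flag_code_def is_flag_def)
  moreover have "finite ?L" by (rule finite_lists_length_eq) simp
  ultimately have "finite {card C | C :: ('a ^ 'n) set list set. aodfc (sorted_list_of_set D) C}"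
    by (meson finite_Pow_iff finite_imageI finite_subset)
  then show ?thesis
    unfolding A_star_def using assms by (intro Max_ge) auto
qed

lemma flag_dist_map:
  assumes "distinct ts"
  shows "flag_dist (map f ts) (map g ts) = (\<Sum>d\<in>set ts. subspace_dist (f d) (g d))"
proof -
  have "flag_dist (map f ts) (map g ts) = (\<Sum>i<length ts. subspace_dist (f (ts ! i)) (g (ts ! i)))"
    by (simp add: flag_dist_def)
  also have "\<dots> = (\<Sum>d\<in>set ts. subspace_dist (f d) (g d))"
    by (rule sum.reindex_bij_betw) (rule bij_betw_nth[OF assms refl refl])
  finally show ?thesis .
qed

lemma dim_UNIV_vec: "vec.dim (UNIV :: ('a::field ^ 'n::finite) set) = CARD('n)"
  by (simp add: card_cart_basis)

text \<open>Each triple is completed to a chain. Its members of dimension below \<open>k\<close> lie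
  in \<open>S\<close> and those above \<open>n - k\<close> contain \<open>W\<close>, so only the
  members \<open>U\<close> can cost distance.\<close>

lemma A_star_ge_family:
  fixes k :: nat
  assumes fam: "strong_family (k - 1) (UNIV :: ('a::{field,finite} ^ 'n::finite) set) N"
    and k: "k \<ge> 2" and n: "CARD('n) = n" "n \<ge> 2 * k"
  shows "N \<le> A_star TYPE('a ^ 'n) ({1..k} \<union> {n - k + 1..n - 1})"
proof -
  let ?D = "{1..k} \<union> {n - k + 1..n - 1}"
  define ts where "ts = sorted_list_of_set ?D"
  have ts: "set ts = ?D" "distinct ts" "sorted_wrt (<) ts"
    by (simp_all add: ts_def)
  have dimV: "vec.dim (UNIV :: ('a ^ 'n) set) = n" using dim_UNIV_vec n(1) by metis
  obtain \<G> where G: "triple_family (k - 1) (UNIV :: ('a ^ 'n) set) \<G>" "card \<G> = N"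
    and UW: "\<And>S U W. (S, U, W) \<in> \<G> \<Longrightarrow> U \<subseteq> W"
    and ex: "\<exists>S U W S' U' W'. (S, U, W) \<in> \<G> \<and> (S', U', W') \<in> \<G> \<and> (S, U, W) \<noteq> (S', U', W') \<and>
        vec.dim (U \<inter> U') = 1"
    using fam unfolding strong_family_def by (elim exE conjE) (rule that; blast)
  have tr: "vec.subspace S" "vec.subspace U" "vec.subspace W" "S \<subseteq> U" "vec.dim S = k - 1" "vec.dim U = k"
      "vec.dim W = n - k + 1"
    if "(S, U, W) \<in> \<G>" for S U W
  proof -
    have *: "is_triple (k - 1) UNIV (S, U, W)" using G(1) that by (simp add: triple_family_def)
    then show "vec.subspace S" "vec.subspace U" "vec.subspace W" "S \<subseteq> U" "vec.dim S = k - 1" "vec.dim U = k"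
      using k by (auto simp: is_triple_def)
    have "vec.dim W + (k - 1) = n" using * dimV by (simp add: is_triple_def)
    then show "vec.dim W = n - k + 1" using k n by linarith
  qed
  have "\<forall>p\<in>\<G>. \<exists>f. (\<forall>d\<le>n. vec.subspace (f d) \<and> vec.dim (f d) = d) \<and> (\<forall>d e. d \<le> e \<longrightarrow> f d \<subseteq> f e) \<and>
      p = (f (k - 1), f k, f (n - k + 1))"
  proof
    fix p assume p: "p \<in> \<G>"
    obtain S U W where SUW: "p = (S, U, W)" by (cases p)
    note t = tr[OF p[unfolded SUW]]
    obtain f where "\<And>d. d \<le> vec.dim (UNIV :: ('a ^ 'n) set) \<Longrightarrow>
        vec.subspace (f d) \<and> vec.dim (f d) = d \<and> f d \<subseteq> UNIV"
      "\<And>d e. d \<le> e \<Longrightarrow> f d \<subseteq> f e"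
      "f (vec.dim S) = S" "f (vec.dim U) = U" "f (vec.dim W) = W"
      using complete_chain[OF t(1-3) vec.subspace_UNIV t(4) UW[OF p[unfolded SUW]] subset_UNIV] by metis
    then show "\<exists>f. (\<forall>d\<le>n. vec.subspace (f d) \<and> vec.dim (f d) = d) \<and> (\<forall>d e. d \<le> e \<longrightarrow> f d \<subseteq> f e) \<and>
      p = (f (k - 1), f k, f (n - k + 1))"
      unfolding dimV t SUW by (intro exI[of _ f]) simp
  qed
  then obtain c where c: "\<And>p d. p \<in> \<G> \<Longrightarrow> d \<le> n \<Longrightarrow> vec.subspace (c p d) \<and> vec.dim (c p d) = d"
      "\<And>p d e. p \<in> \<G> \<Longrightarrow> d \<le> e \<Longrightarrow> c p d \<subseteq> c p e"
      "\<And>p. p \<in> \<G> \<Longrightarrow> p = (c p (k - 1), c p k, c p (n - k + 1))"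
    by (metis (no_types, lifting))
  define flag where "flag p = map (c p) ts" for p
  have ts_n: "0 < d \<and> d < n" if "d \<in> set ts" for d
    using that ts(1) k n(2) by auto
  have is_flag: "is_flag ts (flag p)" if p: "p \<in> \<G>" for p
  proof -
    have "c p d \<subset> c p e" if "d \<in> set ts" "e \<in> set ts" "d < e" for d e
    proof -
      have "d \<le> n" "e \<le> n" using that ts_n by force+
      then have "vec.dim (c p d) \<noteq> vec.dim (c p e)"
        using c(1)[OF p] that by auto
      moreover have "c p d \<subseteq> c p e" using c(2)[OF p] that by simp
      ultimately show ?thesis by auto
    qed
    then have "sorted_wrt (\<subset>) (flag p)"
      unfolding flag_def sorted_wrt_map using ts(3) by (rule sorted_wrt_mono_rel)
    moreover have "vec.subspace (c p (ts ! i)) \<and> vec.dim (c p (ts ! i)) = ts ! i" if "i < length ts" for i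
      using c(1)[OF p, of "ts ! i"] ts_n[OF nth_mem[OF that]] by simp
    ultimately show ?thesis
      using ts ts_n n(1) by (auto simp: is_flag_def flag_def)
  qed
  have split: "(\<Sum>d\<in>?D. h d) = (\<Sum>d\<in>{1..k - 1}. h d) + h k + (\<Sum>d\<in>{n - k + 1..n - 1}. h d)" for h :: "nat \<Rightarrow> int"
  proof -
    have "(\<Sum>d\<in>{1..k}. h d) = (\<Sum>d\<in>{1..k - 1}. h d) + h k"
      using k by (cases k) auto
    moreover have "(\<Sum>d\<in>?D. h d) = (\<Sum>d\<in>{1..k}. h d) + (\<Sum>d\<in>{n - k + 1..n - 1}. h d)"
      using n by (intro sum.union_disjoint) auto
    ultimately show ?thesis by simp
  qed
  \<comment> \<open>\<open>n \<ge> 2 * k\<close> puts \<open>k\<close> among the small dimensions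
    and \<open>n - k + 1\<close> among the large ones.\<close>
  have max: "max_flag_dist n ts = 2 * ((\<Sum>d\<in>{1..k - 1}. int d) + int k + (\<Sum>d\<in>{n - k + 1..n - 1}. int n - int d))"
  proof -
    have "{d. d \<in> set ts \<and> d \<le> n div 2} = insert k {1..k - 1}"
      using ts(1) k n(2) by auto
    moreover have "{d. d \<in> set ts \<and> d > n div 2} = {n - k + 1..n - 1}"
      using ts(1) k n(2) by auto
    moreover have "k \<notin> {1..k - 1}" using k by simp
    ultimately show ?thesis
      unfolding max_flag_dist_def by (simp only: sum.insert finite_atLeastAtMost) simp
  qed
  have dist: "flag_dist (flag p) (flag p') = max_flag_dist n ts - 2 * int (vec.dim (c p k \<inter> c p' k))"
      and le1: "vec.dim (c p k \<inter> c p' k) \<le> 1"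
      and S0: "c p (k - 1) \<inter> c p' (k - 1) \<subseteq> {0}"
    if p: "p \<in> \<G>" "p' \<in> \<G>" "p \<noteq> p'" for p p'
  proof -
    have "triple_compat UNIV p p'"
      using G(1) p by (auto simp: triple_family_def dest: pairwiseD)
    then have "triple_compat UNIV (c p (k - 1), c p k, c p (n - k + 1)) (c p' (k - 1), c p' k, c p' (n - k + 1))"
      using c(3)[OF p(1)] c(3)[OF p(2)] by metis
    then have cmp: "c p (k - 1) \<inter> c p' (k - 1) \<subseteq> {0}" "vec.dim (c p k \<inter> c p' k) \<le> 1"
        "ssum (c p (n - k + 1)) (c p' (n - k + 1)) = UNIV"
      by (auto simp: triple_compat_def)
    then show "vec.dim (c p k \<inter> c p' k) \<le> 1" "c p (k - 1) \<inter> c p' (k - 1) \<subseteq> {0}" by blast+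
    have 1: "subspace_dist (c p d) (c p' d) = 2 * int d" if "d \<in> {1..k - 1}" for d
    proof -
      have "c p d \<inter> c p' d \<subseteq> {0}"
        using c(2)[OF p(1), of d "k - 1"] c(2)[OF p(2), of d "k - 1"] cmp(1) that by auto
      then have "vec.dim (c p d \<inter> c p' d) = 0" by simp
      moreover have "d \<le> n" using that n(2) by auto
      ultimately show ?thesis
        using c(1)[OF p(1), of d] c(1)[OF p(2), of d] by (simp add: subspace_dist_def del: vec.dim_eq_0)
    qed
    have 2: "subspace_dist (c p k) (c p' k) = 2 * int k - 2 * int (vec.dim (c p k \<inter> c p' k))"
      using c(1)[OF p(1), of k] c(1)[OF p(2), of k] n by (simp add: subspace_dist_def)
    \<comment> \<open>Two spaces of dimension \<open>d\<close> whose sum is everything meet in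
      dimension \<open>2 * d - n\<close>.\<close>
    have 3: "subspace_dist (c p d) (c p' d) = 2 * (int n - int d)" if d: "d \<in> {n - k + 1..n - 1}" for d
    proof -
      have "ssum (c p (n - k + 1)) (c p' (n - k + 1)) \<subseteq> ssum (c p d) (c p' d)"
        using c(2)[OF p(1), of "n - k + 1" d] c(2)[OF p(2), of "n - k + 1" d] d by (intro ssum_mono) auto
      then have "ssum (c p d) (c p' d) = UNIV" using cmp(3) by auto
      moreover have cd: "vec.subspace (c p d)" "vec.dim (c p d) = d" "vec.subspace (c p' d)" "vec.dim (c p' d) = d"
        using c(1)[OF p(1), of d] c(1)[OF p(2), of d] d by auto
      ultimately have "n + vec.dim (c p d \<inter> c p' d) = d + d"
        using vec.dim_sums_Int[OF cd(1,3)] dimV by (simp add: ssum_def)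
      then show ?thesis using cd by (simp add: subspace_dist_def)
    qed
    have "flag_dist (flag p) (flag p') = (\<Sum>d\<in>?D. subspace_dist (c p d) (c p' d))"
      unfolding flag_def using flag_dist_map[OF ts(2)] ts(1) by metis
    also have "\<dots> = (\<Sum>d\<in>{1..k - 1}. 2 * int d) + (2 * int k - 2 * int (vec.dim (c p k \<inter> c p' k))) +
        (\<Sum>d\<in>{n - k + 1..n - 1}. 2 * (int n - int d))"
      unfolding split using 1 2 3 by (intro arg_cong2[where f = "(+)"] sum.cong) auto
    also have "\<dots> = max_flag_dist n ts - 2 * int (vec.dim (c p k \<inter> c p' k))"
      unfolding max by (simp only: sum_distrib_left[symmetric] distrib_left)
    finally show "flag_dist (flag p) (flag p') = max_flag_dist n ts - 2 * int (vec.dim (c p k \<inter> c p' k))" .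
  qed
  have inj: "inj_on flag \<G>"
  proof (rule inj_onI, rule ccontr)
    fix p p' assume p: "p \<in> \<G>" "p' \<in> \<G>" "flag p = flag p'" "p \<noteq> p'"
    have "k - 1 \<in> set ts" using ts(1) k by auto
    then have "c p (k - 1) = c p' (k - 1)" using p(3) by (auto simp: flag_def)
    then have "c p (k - 1) \<subseteq> {0}" using S0[OF p(1,2,4)] by simp
    then have "vec.dim (c p (k - 1)) = 0" by simp
    moreover have "vec.dim (c p (k - 1)) = k - 1" using c(1)[OF p(1), of "k - 1"] n by simp
    ultimately show False using k by linarith
  qed
  define C where "C = flag ` \<G>"
  have cardC: "card C = N" unfolding C_def using inj G(2) by (simp add: card_image)
  obtain p p' where pp: "p \<in> \<G>" "p' \<in> \<G>" "p \<noteq> p'" "vec.dim (c p k \<inter> c p' k) = 1"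
  proof -
    obtain S U W S' U' W' where *: "(S, U, W) \<in> \<G>" "(S', U', W') \<in> \<G>" "(S, U, W) \<noteq> (S', U', W')"
        "vec.dim (U \<inter> U') = 1"
      using ex by blast
    have "U = c (S, U, W) k" "U' = c (S', U', W') k"
      using c(3)[OF *(1)] c(3)[OF *(2)] by blast+
    then show thesis using that[OF *(1,2,3)] *(4) by simp
  qed
  \<comment> \<open>Two different flags exist, so the minimum distance is not the default value
    0.\<close>
  have "card C \<noteq> 0 \<and> card C \<noteq> 1"
  proof -
    have "flag p \<noteq> flag p'" using inj pp by (auto dest: inj_onD)
    then have "card {flag p, flag p'} = 2" by simp
    moreover have "{flag p, flag p'} \<subseteq> C" using pp by (auto simp: C_def)
    moreover have "finite C" unfolding C_def by (rule finite_imageI) simp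
    ultimately have "2 \<le> card C" by (metis card_mono)
    then show ?thesis by linarith
  qed
  then have c1: "\<not> card C \<le> 1" by linarith
  have "Min {flag_dist F F' | F F'. F \<in> C \<and> F' \<in> C \<and> F \<noteq> F'} = max_flag_dist n ts - 2"
  proof (rule Min_eqI)
    have "finite C" unfolding C_def by (rule finite_imageI) simp
    then have "finite ((\<lambda>(F, F'). flag_dist F F') ` (C \<times> C))" by simp
    then show "finite {flag_dist F F' | F F'. F \<in> C \<and> F' \<in> C \<and> F \<noteq> F'}"
      by (rule finite_subset[rotated]) auto
    show "max_flag_dist n ts - 2 \<le> d" if "d \<in> {flag_dist F F' | F F'. F \<in> C \<and> F' \<in> C \<and> F \<noteq> F'}" for d
    proof -
      from that obtain g g' where g: "g \<in> \<G>" "g' \<in> \<G>" "flag g \<noteq> flag g'" "d = flag_dist (flag g) (flag g')"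
        unfolding C_def by blast
      then have "g \<noteq> g'" by blast
      then show ?thesis using dist[OF g(1,2)] le1[OF g(1,2)] g(4) by simp
    qed
    have "flag_dist (flag p) (flag p') = max_flag_dist n ts - 2" "flag p \<noteq> flag p'"
      using dist[OF pp(1,2,3)] pp inj by (auto dest: inj_onD)
    then show "max_flag_dist n ts - 2 \<in> {flag_dist F F' | F F'. F \<in> C \<and> F' \<in> C \<and> F \<noteq> F'}"
      using pp(1,2) unfolding C_def by force
  qed
  then have "aodfc ts C"
    using is_flag c1 n(1) pp(1) by (auto simp: aodfc_def flag_code_def min_flag_dist_def C_def)
  then show ?thesis
    using A_star_ge[of ?D C] cardC by (simp add: ts_def)
qed

theorem theorem4p4:
  fixes q n k r :: nat
  assumes "CARD('a::{field,finite}) = q"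
    and "CARD('n::finite) = n"
    and "k \<ge> 2"
    and "n \<ge> 2 * k"
    and "[r = n] (mod (k - 1))"
    and "r < k - 1"
  shows "real (A_star TYPE('a ^ 'n) ({1..k} \<union> {n - k + 1..n - 1}))
           \<ge> (real q ^ n - real q ^ (k + r - 1)) / (real q ^ (k - 1) - 1) + 1"
proof -
  define t where "t = k - 1"
  have t: "t \<noteq> 0" "k = t + 1" "r < t" "2 * t + 2 \<le> n" using assms by (auto simp: t_def)
  have "n mod t = r" using assms(5) t(3) by (simp add: t_def unique_euclidean_semiring_class.cong_def)
  then have nm: "n = n div t * t + r" using div_mult_mod_eq[of n t] by simp
  \<comment> \<open>\<open>M\<close> counts the steps of size \<open>t\<close> from dimension
    \<open>t + r\<close> up to \<open>n\<close>.\<close>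
  define M where "M = n div t - 1"
  \<comment> \<open>A quotient of at most 1 would give \<open>n < 2 * t\<close>; for
    \<open>r = 0\<close>, a quotient of at most 2 would give \<open>n \<le> 2 * t\<close>.\<close>
  have "n div t \<ge> 2 \<and> (r = 0 \<longrightarrow> n div t \<ge> 3)"
  proof (intro conjI impI; rule ccontr)
    assume "\<not> 2 \<le> n div t"
    then have "n div t * t \<le> 1 * t" by (intro mult_le_mono1) simp
    then show False using nm t by linarith
  next
    assume r: "r = 0" and "\<not> 3 \<le> n div t"
    then have "n div t * t \<le> 2 * t" by (intro mult_le_mono1) simp
    then show False using nm t r by linarith
  qed
  then have M: "n div t = M + 1" "r \<noteq> 0 \<and> M \<ge> 1 \<or> r = 0 \<and> M \<ge> 2"
    by (auto simp: M_def)
  have n: "n = t + r + M * t" using nm by (simp add: M(1))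
  define N where "N = 1 + (\<Sum>i<M. q ^ (t + r + i * t))"
  have "vec.dim (UNIV :: ('a ^ 'n) set) = t + r + M * t"
    using dim_UNIV_vec assms(2) n by metis
  with t(1) M(2) vec.subspace_UNIV
  have "strong_family t (UNIV :: ('a ^ 'n) set) (1 + (\<Sum>i<M. CARD('a) ^ (t + r + i * t)))"
    by (rule strong_family_exists)
  then have "strong_family (k - 1) (UNIV :: ('a ^ 'n) set) N"
    unfolding N_def t_def[symmetric] assms(1) .
  then have "N \<le> A_star TYPE('a ^ 'n) ({1..k} \<union> {n - k + 1..n - 1})"
    by (rule A_star_ge_family) (use assms in auto)
  \<comment> \<open>A geometric series with ratio \<open>q ^ t\<close> and first term
    \<open>q ^ (t + r)\<close>, where \<open>t + r = k + r - 1\<close>.\<close>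
  moreover have "real N = (real q ^ n - real q ^ (k + r - 1)) / (real q ^ (k - 1) - 1) + 1"
  proof -
    have "q ^ t \<ge> 2"
      using card_field_ge_2[where ?'a='a] self_le_power[of q t] t(1) assms(1) by simp
    then have "real q ^ t \<noteq> 1"
      by (metis of_nat_1_eq_iff of_nat_power numeral_le_one_iff semiring_norm(69))
    then have "(\<Sum>i<M. (real q ^ t) ^ i) = ((real q ^ t) ^ M - 1) / (real q ^ t - 1)"
      by (rule geometric_sum)
    moreover have "real N = 1 + real q ^ (t + r) * (\<Sum>i<M. (real q ^ t) ^ i)"
      by (simp add: N_def power_add sum_distrib_left mult.commute[of _ t] power_mult)
    moreover have "real q ^ n = real q ^ (t + r) * (real q ^ t) ^ M"
      unfolding n by (simp add: power_add mult.commute[of M t] power_mult)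
    ultimately show ?thesis
      by (simp add: t(2) right_diff_distrib)
  qed
  ultimately show ?thesis by (metis of_nat_le_iff)
qed

end
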